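(* Let $s:\mathbf{R}\to\mathbf{R}$ be strictly increasing and absolutely continuous with $s'(x)\in\{0,1\}$ for a.e. $x$, and assume that the set $G=\{x\in\mathbf{R}: s'(x)=1\}$ (defined up to Lebesgue-null sets) has an open version, again denoted $G$. Let $(\mathcal{E},\mathcal{F})=(\frac12\mathbf{D},H^1(\mathbf{R}))$ be the Dirichlet form of one-dimensional Brownian motion and $(\mathcal{E}^{(s)},\mathcal{F}^{(s)})$ its regular subspace with scaling function $s$, with extended Dirichlet spaces $\mathcal{F}_{\mathrm e}$ and $\mathcal{F}^{(s)}_{\mathrm e}$. Fix a constant $\alpha\ge 0$, and let $\mathcal{G}^{(s)}_\alpha$ be the orthogonal complement of the regular subspace, that is, for $\alpha>0$, $$\mathcal{G}^{(s)}_\alpha=\{u\in\mathcal{F}:\ \mathcal{E}_\alpha(u,v)=0\ \text{for any } v\in\mathcal{F}^{(s)}\},$$ and for $\alpha=0$ the pseudo orthogonal complement in the extended Dirichlet space, $$\mathcal{G}^{(s)}_0=\mathcal{G}^{(s)}=\{u\in\mathcal{F}_{\mathrm e}:\ \mathcal{E}(u,v)=0\ \text{for any } v\in\mathcal{F}^{(s)}_{\mathrm e}\}.$$ Then $$\mathcal{G}^{(s)}_\alpha=\Big\{u\in\mathcal{F}:\ u'(x)-u'(y)=2\alpha\int_y^x u(z)\,dz\ \text{ for a.e. } x,y\in G\Big\},$$ where for $\alpha=0$ the space $\mathcal{F}$ on the right-hand side is to be read as $\mathcal{F}_{\mathrm e}$. In particular, when $\alpha=0$, this formula has the same form as the description $$\mathcal{G}^{(s)}=\{u\in\mathcal{F}_{\mathrm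 e}:\ u'\ \text{is a constant a.e. on } G\}.$$
   Context: All measure-theoretic statements refer to Lebesgue measure on $\mathbf{R}$. Functions in $H^1(\mathbf{R})$ are identified with their continuous versions. The Dirichlet form of one-dimensional Brownian motion on $L^2(\mathbf{R})$ is $(\mathcal{E},\mathcal{F})$ with $\mathcal{F}=H^1(\mathbf{R})$ and $\mathcal{E}(u,v)=\frac12\mathbf{D}(u,v)=\frac12\int_{\mathbf{R}}u'(x)v'(x)\,dx$. For $\alpha>0$, $\mathcal{E}_\alpha(u,v)=\mathcal{E}(u,v)+\alpha\int_{\mathbf{R}}u(x)v(x)\,dx$ for $u,v\in\mathcal{F}$; $\mathcal{F}$ is a Hilbert space under $\mathcal{E}_\alpha$ and $\mathcal{F}^{(s)}$ is a closed subspace of it. The regular subspace of $(\mathcal{E},\mathcal{F})$ with scaling function $s$ is the regular Dirichlet form on $L^2(\mathbf{R})$ given by $$\mathcal{F}^{(s)}=\Big\{u\in L^2(\mathbf{R}):\ u\ll s,\ \int_{\mathbf{R}}\Big(\frac{du}{ds}\Big)^2ds<\infty\Big\},\qquad \mathcal{E}^{(s)}(u,v)=\frac12\int_{\mathbf{R}}\frac{du}{ds}\frac{dv}{ds}\,ds,$$ where $u\ll s$ means that $u$ is absolutely continuous with respect to $s$. One has $\mathcal{F}^{(s)}\subset\mathcal{F}$ and $\mathcal{E}^{(s)}=\mathcal{E}$ on $\mathcal{F}^{(s)}\times\mathcal{F}^{(s)}$. The extended Dirichlet space of a Dirichlet form is the set of a.e. finite functions that are a.e. limits of sequences in its domain that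 are Cauchy with respect to the form; the form extends to it. Here $\mathcal{F}_{\mathrm e}=H^1_{\mathrm e}(\mathbf{R})=\{f: f\text{ is absolutely continuous and } f'\in L^2(\mathbf{R})\}$, with $\mathcal{E}(u,v)=\frac12\int_{\mathbf{R}}u'v'\,dx$ for $u,v\in\mathcal{F}_{\mathrm e}$, and $\mathcal{F}^{(s)}_{\mathrm e}\subset\mathcal{F}_{\mathrm e}$ is the extended Dirichlet space of $(\mathcal{E}^{(s)},\mathcal{F}^{(s)})$. "For a.e. $x,y\in G$" means: there is a Lebesgue-null set $N$ such that the identity holds for all $x,y\in G\setminus N$. *)

theory Defs
  imports "HOL-Analysis.Analysis"
begin

(* abs_cont_wrt s u: the function u is absolutely continuous with respect to the nondecreasing
   function s ("u << s"), locally on R, i.e. on every compact interval [a,b].  A finite set P of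
   pairs (c,d) stands for the family of nonoverlapping subintervals [c,d]. *)
definition abs_cont_wrt :: "(real \<Rightarrow> real) \<Rightarrow> (real \<Rightarrow> real) \<Rightarrow> bool" where
  "abs_cont_wrt s u \<longleftrightarrow>
     (\<forall>a b. \<forall>\<epsilon>>0. \<exists>\<delta>>0. \<forall>P :: (real \<times> real) set.
        finite P \<and> (\<forall>(c, d) \<in> P. a \<le> c \<and> c < d \<and> d \<le> b) \<and>
        pairwise (\<lambda>(c, d) (c', d'). {c<..<d} \<inter> {c'<..<d'} = {}) P \<and>
        (\<Sum>(c, d) \<in> P. s d - s c) < \<delta> \<longrightarrow>
        (\<Sum>(c, d) \<in> P. \<bar>u d - u c\<bar>) < \<epsilon>)"

definition abs_cont :: "(real \<Rightarrow> real) \<Rightarrow> bool" where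
  "abs_cont u \<longleftrightarrow> abs_cont_wrt (\<lambda>x. x) u"

definition L2 :: "real measure \<Rightarrow> (real \<Rightarrow> real) set" where
  "L2 M = {f \<in> borel_measurable M. integrable M (\<lambda>x. (f x)\<^sup>2)}"

(* H^1(R) and its extended space consist of the continuous (absolutely continuous) versions, so
   that the elements are genuine functions.  The total function deriv has a fixed arbitrary value
   where u is not differentiable, which for absolutely continuous u is a Lebesgue-null set. *)
definition H1 :: "(real \<Rightarrow> real) set" where
  "H1 = {u. abs_cont u \<and> u \<in> L2 lebesgue \<and> deriv u \<in> L2 lebesgue}"

definition H1e :: "(real \<Rightarrow> real) set" where
  "H1e = {u. abs_cont u \<and> deriv u \<in> L2 lebesgue}"

definition Eform :: "(real \<Rightarrow> real) \<Rightarrow> (real \<Rightarrow> real) \<Rightarrow> real" where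
  "Eform u v = 1/2 * (LINT x|lebesgue. deriv u x * deriv v x)"

definition Eform_alpha :: "real \<Rightarrow> (real \<Rightarrow> real) \<Rightarrow> (real \<Rightarrow> real) \<Rightarrow> real" where
  "Eform_alpha \<alpha> u v = Eform u v + \<alpha> * (LINT x|lebesgue. u x * v x)"

(* h is a version of the Radon-Nikodym density du/ds; interval_measure s is the
   Lebesgue-Stieltjes measure ds. *)
definition is_ds_density :: "(real \<Rightarrow> real) \<Rightarrow> (real \<Rightarrow> real) \<Rightarrow> (real \<Rightarrow> real) \<Rightarrow> bool" where
  "is_ds_density s u h \<longleftrightarrow>
     h \<in> borel_measurable (interval_measure s) \<and>
     (\<forall>a b. a \<le> b \<longrightarrow>
        set_integrable (interval_measure s) {a<..b} h \<and>
        u b - u a = (LINT x:{a<..b}|interval_measure s. h x))"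

(* The density is unique up to ds-null sets and exists when u << s, so that the choice made here
   affects neither membership in Fs nor the value of Es. *)
definition ds_deriv :: "(real \<Rightarrow> real) \<Rightarrow> (real \<Rightarrow> real) \<Rightarrow> real \<Rightarrow> real" where
  "ds_deriv s u = (SOME h. is_ds_density s u h)"

definition Fs :: "(real \<Rightarrow> real) \<Rightarrow> (real \<Rightarrow> real) set" where
  "Fs s = {u \<in> L2 lebesgue. abs_cont_wrt s u \<and> ds_deriv s u \<in> L2 (interval_measure s)}"

definition Es :: "(real \<Rightarrow> real) \<Rightarrow> (real \<Rightarrow> real) \<Rightarrow> (real \<Rightarrow> real) \<Rightarrow> real" where
  "Es s u v = 1/2 * (LINT x|interval_measure s. ds_deriv s u x * ds_deriv s v x)"

(* The extended Dirichlet space of a form E with domain D; a.e. finiteness is built into the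
   codomain real. *)
definition extended_dirichlet_space ::
  "(real \<Rightarrow> real) set \<Rightarrow> ((real \<Rightarrow> real) \<Rightarrow> (real \<Rightarrow> real) \<Rightarrow> real) \<Rightarrow> (real \<Rightarrow> real) set" where
  "extended_dirichlet_space D E =
     {u \<in> borel_measurable lebesgue. \<exists>f :: nat \<Rightarrow> real \<Rightarrow> real.
        (\<forall>n. f n \<in> D) \<and>
        (\<forall>\<epsilon>>0. \<exists>N. \<forall>m\<ge>N. \<forall>n\<ge>N. E (\<lambda>x. f m x - f n x) (\<lambda>x. f m x - f n x) < \<epsilon>) \<and>
        (AE x in lebesgue. (\<lambda>n. f n x) \<longlonglongrightarrow> u x)}"

(* As for H1, elements are identified with their continuous versions. *)
definition Fse :: "(real \<Rightarrow> real) \<Rightarrow> (real \<Rightarrow> real) set" where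
  "Fse s = {u \<in> extended_dirichlet_space (Fs s) (Es s). continuous_on UNIV u}"

definition orth_compl :: "(real \<Rightarrow> real) \<Rightarrow> real \<Rightarrow> (real \<Rightarrow> real) set" where
  "orth_compl s \<alpha> =
     (if \<alpha> = 0 then {u \<in> H1e. \<forall>v \<in> Fse s. Eform u v = 0}
      else {u \<in> H1. \<forall>v \<in> Fs s. Eform_alpha \<alpha> u v = 0})"

end

theory Submission
  imports Defs
begin

text \<open>
  Since \<open>s' \<in> {0, 1}\<close> almost everywhere, the Stieltjes measure \<open>ds\<close> is Lebesgue measure restricted to
  \<open>G\<close>. Hence a function \<open>v \<lless> s\<close> is an absolutely continuous function whose ordinary derivative is
  the density \<open>dv/ds\<close> on \<open>G\<close> and vanishes off \<open>G\<close>, and the regular subspace consists of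
  the square integrable \<open>v \<lless> s\<close> with \<open>v' \<in> L\<^sup>2\<close>. Orthogonality to all of these constrains \<open>u'\<close> on \<open>G\<close>
  only.

  Let \<open>U\<close> be an antiderivative of \<open>u\<close>. Integrating by parts,
  \<open>\<E>\<^sub>\<alpha>(u, v) = \<integral> (u'/2 - \<alpha> U) v'\<close> for \<open>v\<close> of compact support. For the difference \<open>v\<close> of two normalised
  ramps that climb along intervals \<open>[c, d]\<close> and \<open>[c', d']\<close> inside the open set \<open>G\<close>, orthogonality says
  that \<open>u' - 2 \<alpha> U\<close> has the same mean over both intervals. So its primitive is affine with one slope
  on all of \<open>G\<close>, and \<open>u' - 2 \<alpha> U\<close> is almost everywhere equal to that slope
  (\<open>orthogonal_imp_affine_on_G\<close>).

  Conversely let \<open>u' - 2 \<alpha> U = c\<close> on \<open>G\<close>. For \<open>\<alpha> > 0\<close> put \<open>W = \<alpha> U + c/2\<close>; then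
  \<open>u' v'/2 + \<alpha> u v = (W v)'\<close>, so the form equals the difference of the limits of \<open>W v\<close> at
  \<open>\<plusminus>\<infinity>\<close>. Both are zero, because \<open>W\<close> grows at most like \<open>\<surd>\<bar>x\<bar>\<close> while \<open>v \<in> L\<^sup>2\<close>: a nonzero limit would
  force \<open>v\<^sup>2 \<ge> const/\<bar>x\<bar>\<close> (\<open>affine_on_G_imp_orthogonal\<close>). For \<open>\<alpha> = 0\<close> the test functions range over the extended
  space, whose members are pointwise limits of functions with bounded energy differences; an elementary
  form of the Cauchy-Schwarz inequality shows that they are still absolutely continuous with respect to \<open>s\<close>.
  If \<open>u' = c \<noteq> 0\<close> on \<open>G\<close>, then \<open>G\<close> has finite measure as \<open>u' \<in> L\<^sup>2\<close>, so \<open>s\<close> has finite limits and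
  elements of the extended space vanish at infinity; hence \<open>\<E>(u, v) = c/2 \<integral> v' = 0\<close>
  (\<open>Eform_eq_0_of_constant_on_G\<close>).

  Two classical facts carry the measure theory: an indefinite integral is differentiable almost everywhere
  with the integrand as derivative (\<open>AE_has_real_derivative_of_has_integral\<close>), and a function that is
  absolutely continuous with respect to a continuous increasing \<open>s\<close> is an indefinite integral against \<open>ds\<close>
  (\<open>abs_cont_wrt_density_exists\<close>).
\<close>

section \<open>Differentiation of indefinite integrals\<close>

lemma AE_lebesgue_iff_negligible: "(AE x in lebesgue. P x) \<longleftrightarrow> negligible {x. \<not> P x}"
  by (simp add: negligible_iff_null_sets eventually_ae_filter) 
     (metis (mono_tags, lifting) mem_Collect_eq negligible_iff_null_sets negligible_subset subsetI)

text \<open>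
  Henstock's lemma bounds the total error \<open>\<bar>F y - F x - f x (y - x)\<bar>\<close> over disjoint intervals with endpoints
  \<open>x\<close> and \<open>y\<close> that are fine for a gauge, while at a bad point each such error exceeds \<open>k \<bar>y - x\<bar>\<close>.
  Hence a disjoint family of bad intervals has small total length, and by the Vitali covering lemma five
  times that length covers all bad points.
\<close>
lemma negligible_bad_points:
  fixes f F :: "real \<Rightarrow> real"
  assumes int: "\<And>a b. a \<le> b \<Longrightarrow> (f has_integral F b - F a) {a..b}" and "k > 0" and "n > 0"
  shows "negligible {x \<in> {-n<..<n}. \<forall>\<eta>>0. \<exists>y. \<bar>y - x\<bar> < \<eta> \<and> k * \<bar>y - x\<bar> < \<bar>F y - F x - f x * (y - x)\<bar>}"
    (is "negligible ?B")
unfolding negligible_outer_le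
proof (intro allI impI)
  fix e :: real assume "e > 0"
  \<comment> \<open>The radii enlarged by the factor 5 then sum to at most \<open>e\<close>.\<close>
  define \<epsilon> where "\<epsilon> = k * e / 5"
  have "\<epsilon> > 0" using \<open>e > 0\<close> \<open>k > 0\<close> by (simp add: \<epsilon>_def)
  have "f integrable_on cbox (-n) n" using int[of "-n" n] \<open>n > 0\<close> by auto
  from Henstock_lemma[OF this \<open>\<epsilon> > 0\<close>] obtain \<gamma> where \<gamma>: "gauge \<gamma>"
    and hen: "\<And>p. p tagged_partial_division_of (cbox (-n) n) \<Longrightarrow> \<gamma> fine p \<Longrightarrow>
       (\<Sum>(x,K)\<in>p. norm (measure lborel K *\<^sub>R f x - integral K f)) < \<epsilon>" by blast
  define seg :: "real \<times> real \<Rightarrow> real set" where "seg = (\<lambda>(x,y). {min x y..max x y})"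
  define K where "K = {(x,y). x \<in> ?B \<and> seg (x,y) \<subseteq> \<gamma> x \<inter> {-n<..<n} \<and> k * \<bar>y - x\<bar> < \<bar>F y - F x - f x * (y - x)\<bar>}"
  \<comment> \<open>A segment has its tag at an endpoint, but as a ball it is centred at its midpoint.\<close>
  define a where "a = (\<lambda>(x,y). (x + y) / 2 :: real)"
  define r where "r = (\<lambda>(x,y). \<bar>y - x\<bar> / 2 :: real)"
  have cb: "cball (a i) (r i) = seg i" for i
    by (cases i) (auto simp: a_def r_def seg_def cball_eq_atLeastAtMost min_def max_def field_simps)
  have r: "0 < r i \<and> r i \<le> n" if "i \<in> K" for i
  proof -
    obtain x y where i: "i = (x,y)" by (cases i)
    have "x \<noteq> y" using that by (auto simp: i K_def)
    moreover have "x \<in> {-n<..<n}" "y \<in> {-n<..<n}"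
      using that by (auto simp: i K_def seg_def subset_iff min_def max_def split: if_splits)
    ultimately show ?thesis by (auto simp: r_def i)
  qed
  have cov: "?B \<subseteq> (\<Union>i\<in>K. cball (a i) (r i))"
  proof
    fix x assume x: "x \<in> ?B"
    have "open (\<gamma> x \<inter> {-n<..<n})" "x \<in> \<gamma> x \<inter> {-n<..<n}" using \<gamma> x by (auto simp: gauge_def)
    then obtain d where "d > 0" and d: "cball x d \<subseteq> \<gamma> x \<inter> {-n<..<n}"
      by (meson open_contains_cball)
    obtain y where y: "\<bar>y - x\<bar> < d" "k * \<bar>y - x\<bar> < \<bar>F y - F x - f x * (y - x)\<bar>"
      using x \<open>d > 0\<close> by blast
    have "seg (x,y) \<subseteq> cball x d" using y(1) by (auto simp: seg_def dist_real_def)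
    then have "(x,y) \<in> K" using d x y by (auto simp: K_def)
    moreover have "x \<in> seg (x,y)" by (auto simp: seg_def)
    ultimately show "x \<in> (\<Union>i\<in>K. cball (a i) (r i))" unfolding cb by blast
  qed
  obtain C where C: "countable C" "C \<subseteq> K"
     and dis: "pairwise (\<lambda>i j. disjnt (cball (a i) (r i)) (cball (a j) (r j))) C"
     and covC: "?B \<subseteq> (\<Union>i\<in>C. cball (a i) (5 * r i))"
    using Vitali_covering_lemma_cballs[OF cov r] by blast
  have bound: "measure lebesgue (\<Union>i\<in>I. cball (a i) (5 * r i)) \<le> e" if I: "I \<subseteq> C" "finite I" for I
  proof -
    define p where "p = (\<lambda>i. (fst i, seg i)) ` I"
    have inj: "inj_on (\<lambda>i. (fst i, seg i)) I"
    proof (rule inj_onI)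
      fix i j assume ij: "i \<in> I" "j \<in> I" and eq: "(fst i, seg i) = (fst j, seg j)"
      then have "fst i \<in> seg i \<inter> seg j" by (auto simp: seg_def split: prod.splits)
      then show "i = j"
        using dis ij I unfolding pairwise_def cb disjnt_def by blast
    qed
    have memK: "i \<in> K" if "i \<in> I" for i using that I C by blast
    have "p tagged_partial_division_of cbox (-n) n"
      unfolding tagged_partial_division_of_def p_def
    proof (intro conjI allI impI)
      fix x L assume "(x, L) \<in> (\<lambda>i. (fst i, seg i)) ` I"
      then obtain y where xy: "(x,y) \<in> I" "L = seg (x,y)" by auto
      show "x \<in> L" by (auto simp: xy seg_def)
      show "L \<subseteq> cbox (- n) n" using memK[OF xy(1)] by (auto simp: xy K_def)
      show "\<exists>a b. L = cbox a b" by (auto simp: xy seg_def)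
    next
      fix x1 L1 x2 L2
      assume *: "(x1, L1) \<in> (\<lambda>i. (fst i, seg i)) ` I \<and> (x2, L2) \<in> (\<lambda>i. (fst i, seg i)) ` I \<and> (x1, L1) \<noteq> (x2, L2)"
      then obtain i j where ij: "i \<in> I" "j \<in> I" "L1 = seg i" "L2 = seg j" "i \<noteq> j" by auto
      then have "L1 \<inter> L2 = {}"
        using dis I unfolding pairwise_def cb disjnt_def by blast
      then show "interior L1 \<inter> interior L2 = {}" using interior_subset by blast
    qed (use I in auto)
    moreover have "\<gamma> fine p" using memK by (fastforce simp: fine_def p_def K_def)
    ultimately have "(\<Sum>(x,L)\<in>p. norm (measure lborel L *\<^sub>R f x - integral L f)) < \<epsilon>" by (rule hen)
    also have "(\<Sum>(x,L)\<in>p. norm (measure lborel L *\<^sub>R f x - integral L f)) =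
       (\<Sum>i\<in>I. norm (measure lborel (seg i) *\<^sub>R f (fst i) - integral (seg i) f))"
      unfolding p_def by (subst sum.reindex[OF inj]) (simp add: o_def)
    finally have sm: "(\<Sum>i\<in>I. norm (measure lborel (seg i) *\<^sub>R f (fst i) - integral (seg i) f)) < \<epsilon>" .
    have "k * (2 * r i) \<le> norm (measure lborel (seg i) *\<^sub>R f (fst i) - integral (seg i) f)" if "i \<in> I" for i
    proof -
      obtain x y where i: "i = (x,y)" by (cases i)
      have I: "integral (seg i) f = F (max x y) - F (min x y)"
        unfolding i seg_def by (simp, rule integral_unique, rule int) simp
      have L: "measure lborel (seg i) = \<bar>y - x\<bar>" by (simp add: i seg_def min_def max_def)
      have "measure lborel (seg i) *\<^sub>R f (fst i) - integral (seg i) f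
          = (if x \<le> y then - 1 else 1) * (F y - F x - f x * (y - x))"
        unfolding I L by (simp add: i min_def max_def algebra_simps)
      then have "norm (measure lborel (seg i) *\<^sub>R f (fst i) - integral (seg i) f) = \<bar>F y - F x - f x * (y - x)\<bar>"
        by (simp add: abs_mult)
      then show ?thesis using memK[OF that] by (auto simp: i r_def K_def)
    qed
    then have "(\<Sum>i\<in>I. k * (2 * r i)) < \<epsilon>" using sm by (smt (verit) sum_mono)
    then have *: "k * (2 * (\<Sum>i\<in>I. r i)) < \<epsilon>" by (simp add: sum_distrib_left)
    have "measure lebesgue (\<Union>i\<in>I. cball (a i) (5 * r i)) \<le> (\<Sum>i\<in>I. measure lebesgue (cball (a i) (5 * r i)))"
      by (rule measure_UNION_le) (use I in auto)
    also have "\<dots> = (\<Sum>i\<in>I. 10 * r i)"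
      by (rule sum.cong) (use r memK in \<open>force simp: cball_eq_atLeastAtMost\<close>)+
    also have "\<dots> \<le> e" using * \<open>k > 0\<close> by (simp add: \<epsilon>_def sum_distrib_left[symmetric])
    finally show ?thesis .
  qed
  show "\<exists>T. ?B \<subseteq> T \<and> T \<in> lmeasurable \<and> measure lebesgue T \<le> e"
  proof (intro exI conjI)
    show "(\<Union>i\<in>C. cball (a i) (5 * r i)) \<in> lmeasurable"
      by (rule fmeasurable_UN_bound[OF \<open>countable C\<close> _ bound]) auto
    show "measure lebesgue (\<Union>i\<in>C. cball (a i) (5 * r i)) \<le> e"
      by (rule measure_UN_bound[OF \<open>countable C\<close> _ bound]) auto
  qed (rule covC)
qed

text \<open>
  The Lebesgue differentiation theorem, stated for the gauge integral so that it applies to Lebesgue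
  measurable and to Borel measurable integrands alike.
\<close>
theorem AE_has_real_derivative_of_has_integral:
  fixes f F :: "real \<Rightarrow> real"
  assumes int: "\<And>a b. a \<le> b \<Longrightarrow> (f has_integral F b - F a) {a..b}"
  shows "AE x in lebesgue. (F has_real_derivative f x) (at x)"
proof -
  define B where "B = (\<lambda>(k::nat,n::nat). {x \<in> {-real (Suc n)<..<real (Suc n)}.
     \<forall>\<eta>>0. \<exists>y. \<bar>y - x\<bar> < \<eta> \<and> inverse (real (Suc k)) * \<bar>y - x\<bar> < \<bar>F y - F x - f x * (y - x)\<bar>})"
  have "negligible (B i)" for i
    unfolding B_def by (cases i) (simp only: split, rule negligible_bad_points[OF int], auto)
  then have "negligible (\<Union> (range B))" by (intro negligible_countable_Union) auto
  moreover have "{x. \<not> (F has_real_derivative f x) (at x)} \<subseteq> \<Union> (range B)"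
  proof safe
    fix x assume nd: "\<not> (F has_real_derivative f x) (at x)"
    have "\<exists>e>0. \<forall>d>0. \<exists>y. \<bar>y - x\<bar> < d \<and> \<not> \<bar>F y - F x - f x * (y - x)\<bar> \<le> e * \<bar>y - x\<bar>"
      using nd unfolding has_field_derivative_def has_derivative_at_alt
      by (auto simp: bounded_linear_mult_right)
    then obtain e where "e > 0" and
      e: "\<And>d. d > 0 \<Longrightarrow> \<exists>y. \<bar>y - x\<bar> < d \<and> e * \<bar>y - x\<bar> < \<bar>F y - F x - f x * (y - x)\<bar>" by (auto simp: not_le)
    obtain k where k: "inverse (real (Suc k)) < e" using reals_Archimedean[OF \<open>e > 0\<close>] by blast
    obtain n where n: "\<bar>x\<bar> < real n" using reals_Archimedean2 by blast
    have "\<exists>y. \<bar>y - x\<bar> < d \<and> inverse (real (Suc k)) * \<bar>y - x\<bar> < \<bar>F y - F x - f x * (y - x)\<bar>" if "d > 0" for d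
      using e[OF that] k by (meson abs_ge_zero le_less_trans less_imp_le mult_right_mono)
    then have "x \<in> B (k, n)" using n by (auto simp: B_def)
    then show "x \<in> \<Union> (range B)" by blast
  qed
  ultimately show ?thesis by (simp add: AE_lebesgue_iff_negligible negligible_subset)
qed

section \<open>Families of nonoverlapping intervals\<close>

text \<open>
  The families of intervals that occur in the definition of absolute continuity. Disjointness of the open
  intervals is expressed by comparing endpoints, which keeps the later arguments within linear arithmetic.
\<close>
definition nonoverlapping :: "real \<Rightarrow> real \<Rightarrow> (real \<times> real) set \<Rightarrow> bool" where
  "nonoverlapping a b P \<longleftrightarrow> finite P \<and> (\<forall>(c, d) \<in> P. a \<le> c \<and> c < d \<and> d \<le> b) \<and>
     pairwise (\<lambda>(c, d) (c', d'). d \<le> c' \<or> d' \<le> c) P"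

lemma abs_cont_wrt_iff:
  "abs_cont_wrt s u \<longleftrightarrow> (\<forall>a b. \<forall>\<epsilon>>0. \<exists>\<delta>>0. \<forall>P. nonoverlapping a b P \<longrightarrow>
     (\<Sum>(c, d) \<in> P. s d - s c) < \<delta> \<longrightarrow> (\<Sum>(c, d) \<in> P. \<bar>u d - u c\<bar>) < \<epsilon>)"
proof -
  have disj: "({c<..<d} \<inter> {c'<..<d'} = {}) \<longleftrightarrow> d \<le> c' \<or> d' \<le> c" if "c < d" "c' < d'" for c d c' d' :: real
    using that by (simp add: min_le_iff_disj le_max_iff_disj) linarith
  have pw: "pairwise (\<lambda>(c, d) (c', d'). {c<..<d} \<inter> {c'<..<d'} = {}) P \<longleftrightarrow>
      pairwise (\<lambda>(c, d) (c', d'). d \<le> c' \<or> d' \<le> c) P"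
    if "\<forall>(c, d)\<in>P. a \<le> c \<and> c < d \<and> d \<le> b" for a b :: real and P
    unfolding pairwise_def
  proof (intro ball_cong refl)
    fix i j assume "i \<in> P" "j \<in> P"
    then have "fst i < snd i" "fst j < snd j" using that by auto
    then show "(i \<noteq> j \<longrightarrow> (case i of (c, d) \<Rightarrow> \<lambda>(c', d'). {c<..<d} \<inter> {c'<..<d'} = {}) j) =
        (i \<noteq> j \<longrightarrow> (case i of (c, d) \<Rightarrow> \<lambda>(c', d'). d \<le> c' \<or> d' \<le> c) j)"
      using disj[of "fst i" "snd i" "fst j" "snd j"] by (simp add: split_beta del: Int_greaterThanLessThan)
  qed
  have "(finite P \<and> (\<forall>(c, d) \<in> P. a \<le> c \<and> c < d \<and> d \<le> b) \<and>
        pairwise (\<lambda>(c, d) (c', d'). {c<..<d} \<inter> {c'<..<d'} = {}) P) = nonoverlapping a b P" for a b P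
    unfolding nonoverlapping_def using pw[of P a b] by blast
  then show ?thesis unfolding abs_cont_wrt_def by (simp only: conj_assoc[symmetric]) (simp add: conj_assoc imp_conjL)
qed

lemma abs_cont_wrtE:
  assumes "abs_cont_wrt s u" "\<epsilon> > 0"
  obtains \<delta> where "\<delta> > 0" "\<And>P. nonoverlapping a b P \<Longrightarrow> (\<Sum>(c, d) \<in> P. s d - s c) < \<delta> \<Longrightarrow> (\<Sum>(c, d) \<in> P. \<bar>u d - u c\<bar>) < \<epsilon>"
  using assms unfolding abs_cont_wrt_iff by metis

lemma nonoverlappingD:
  assumes "nonoverlapping a b P"
  shows "finite P" "\<And>c d. (c, d) \<in> P \<Longrightarrow> a \<le> c \<and> c < d \<and> d \<le> b"
    "\<And>c d c' d'. (c, d) \<in> P \<Longrightarrow> (c', d') \<in> P \<Longrightarrow> (c, d) \<noteq> (c', d') \<Longrightarrow> d \<le> c' \<or> d' \<le> c"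
  using assms unfolding nonoverlapping_def pairwise_def by fast+

lemma nonoverlapping_single: "a \<le> c \<Longrightarrow> c < d \<Longrightarrow> d \<le> b \<Longrightarrow> nonoverlapping a b {(c, d)}"
  by (simp add: nonoverlapping_def)

lemma nonoverlapping_empty: "nonoverlapping a b {}"
  by (simp add: nonoverlapping_def)

lemma nonoverlapping_mono: "nonoverlapping a b P \<Longrightarrow> a' \<le> a \<Longrightarrow> b \<le> b' \<Longrightarrow> nonoverlapping a' b' P"
  unfolding nonoverlapping_def by fastforce

lemma nonoverlapping_append:
  assumes P: "nonoverlapping a b P" and Q: "nonoverlapping b c Q" and "a \<le> b" "b \<le> c"
  shows "nonoverlapping a c (P \<union> Q)" "P \<inter> Q = {}"
  using nonoverlappingD[OF P] nonoverlappingD[OF Q] assms(3,4)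
  unfolding nonoverlapping_def pairwise_def by (fastforce, fastforce)

lemma nonoverlapping_refine:
  assumes P: "nonoverlapping a b P" and Q: "\<And>i. i \<in> P \<Longrightarrow> nonoverlapping (fst i) (snd i) (Q i)"
  shows "nonoverlapping a b (\<Union>i\<in>P. Q i)" "\<And>i j. i \<in> P \<Longrightarrow> j \<in> P \<Longrightarrow> i \<noteq> j \<Longrightarrow> Q i \<inter> Q j = {}"
proof -
  note PD = nonoverlappingD[OF P]
  have QD: "fst i \<le> c" "c < d" "d \<le> snd i" if "i \<in> P" "(c,d) \<in> Q i" for i c d
    using nonoverlappingD(2)[OF Q[OF that(1)] that(2)] by auto
  have sep: "d \<le> c' \<or> d' \<le> c" if "i \<in> P" "j \<in> P" "i \<noteq> j" "(c,d) \<in> Q i" "(c',d') \<in> Q j" for i j c d c' d'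
    using PD(3)[of "fst i" "snd i" "fst j" "snd j"] QD[of i c d] QD[of j c' d'] that
    by (metis order_trans prod.collapse)
  show "Q i \<inter> Q j = {}" if "i \<in> P" "j \<in> P" "i \<noteq> j" for i j
    using sep[OF that] QD(2)[OF that(1)] by fastforce
  show "nonoverlapping a b (\<Union>i\<in>P. Q i)"
    unfolding nonoverlapping_def
  proof (intro conjI)
    show "finite (\<Union>i\<in>P. Q i)" using PD(1) nonoverlappingD(1)[OF Q] by auto
    show "\<forall>(c, d)\<in>\<Union>i\<in>P. Q i. a \<le> c \<and> c < d \<and> d \<le> b"
      using QD PD(2) by (fastforce)
    show "pairwise (\<lambda>(c, d) (c', d'). d \<le> c' \<or> d' \<le> c) (\<Union>i\<in>P. Q i)"
    proof (clarsimp simp: pairwise_def)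
      fix c d i1 i2 c' d' j1 j2
      assume "(i1,i2) \<in> P" "(c,d) \<in> Q (i1,i2)" "(j1,j2) \<in> P" "(c',d') \<in> Q (j1,j2)" "c = c' \<longrightarrow> d \<noteq> d'" "\<not> d' \<le> c"
      then show "d \<le> c'"
        using sep[of "(i1,i2)" "(j1,j2)" c d c' d'] nonoverlappingD(3)[OF Q[of "(i1,i2)"], of c d c' d']
        by (cases "(i1,i2) = (j1,j2)") auto
    qed
  qed
qed

text \<open>
  At most one interval of the family straddles \<open>b\<close>; cutting it there changes no telescoping sum of
  increments.
\<close>
lemma nonoverlapping_split:
  assumes P: "nonoverlapping a c P" and "a \<le> b" "b \<le> c"
  obtains P1 P2 where "nonoverlapping a b P1" "nonoverlapping b c P2"
    "\<And>f :: real \<Rightarrow> real. (\<Sum>(x, y)\<in>P. f y - f x) = (\<Sum>(x, y)\<in>P1. f y - f x) + (\<Sum>(x, y)\<in>P2. f y - f x)"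
proof -
  note PD = nonoverlappingD[OF P]
  define L where "L = {i \<in> P. fst i < b}"
  define R where "R = {i \<in> P. b < snd i}"
  define l where "l = (\<lambda>i::real \<times> real. (fst i, min (snd i) b))"
  define r where "r = (\<lambda>i::real \<times> real. (max (fst i) b, snd i))"
  have sep: "snd i \<le> fst j \<or> snd j \<le> fst i" if "i \<in> P" "j \<in> P" "i \<noteq> j" for i j
    using PD(3)[of "fst i" "snd i" "fst j" "snd j"] that by auto
  have ord: "a \<le> fst i" "fst i < snd i" "snd i \<le> c" if "i \<in> P" for i
    using PD(2)[of "fst i" "snd i"] that by auto
  have injl: "inj_on l L"
  proof (rule inj_onI, rule ccontr)
    fix i j assume "i \<in> L" "j \<in> L" "l i = l j" "i \<noteq> j"
    then show False using sep[of i j] ord[of i] ord[of j] by (auto simp: L_def l_def)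
  qed
  have injr: "inj_on r R"
  proof (rule inj_onI, rule ccontr)
    fix i j assume "i \<in> R" "j \<in> R" "r i = r j" "i \<noteq> j"
    then show False using sep[of i j] ord[of i] ord[of j] by (auto simp: R_def r_def)
  qed
  have 1: "nonoverlapping a b (l ` L)"
    unfolding nonoverlapping_def
  proof (intro conjI)
    show "pairwise (\<lambda>(c, d) (c', d'). d \<le> c' \<or> d' \<le> c) (l ` L)"
      unfolding pairwise_def using sep by (fastforce simp: L_def l_def)
  qed (use ord PD(1) in \<open>auto simp: L_def l_def\<close>)
  have 2: "nonoverlapping b c (r ` R)"
    unfolding nonoverlapping_def
  proof (intro conjI)
    show "pairwise (\<lambda>(c, d) (c', d'). d \<le> c' \<or> d' \<le> c) (r ` R)"
      unfolding pairwise_def using sep by (fastforce simp: R_def r_def)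
  qed (use ord PD(1) in \<open>auto simp: R_def r_def\<close>)
  have 3: "(\<Sum>(x, y)\<in>P. f y - f x) = (\<Sum>(x, y)\<in>l ` L. f y - f x) + (\<Sum>(x, y)\<in>r ` R. f y - f x)"
    for f :: "real \<Rightarrow> real"
  proof -
    have "(\<Sum>(x, y)\<in>P. f y - f x) = (\<Sum>i\<in>P. (if fst i < b then f (min (snd i) b) - f (fst i) else 0)
         + (if b < snd i then f (snd i) - f (max (fst i) b) else 0))"
      by (rule sum.cong) (use ord in \<open>fastforce simp: min_def max_def\<close>)+
    also have "\<dots> = (\<Sum>i\<in>L. f (min (snd i) b) - f (fst i)) + (\<Sum>i\<in>R. f (snd i) - f (max (fst i) b))"
      unfolding sum.distrib L_def R_def by (simp add: sum.inter_filter[OF PD(1)])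
    also have "\<dots> = (\<Sum>(x, y)\<in>l ` L. f y - f x) + (\<Sum>(x, y)\<in>r ` R. f y - f x)"
      by (simp add: sum.reindex[OF injl] sum.reindex[OF injr]) (simp add: l_def r_def)
    finally show ?thesis .
  qed
  show thesis using that[OF 1 2 3] .
qed

lemma sum_increments_le:
  fixes s :: "real \<Rightarrow> real"
  assumes "mono s" "nonoverlapping a b P" "a \<le> b"
  shows "(\<Sum>(c, d)\<in>P. s d - s c) \<le> s b - s a"
  using assms(2,3)
proof (induction "card P" arbitrary: P b)
  case 0
  then show ?case using monoD[OF \<open>mono s\<close>, of a b] by (auto dest: nonoverlappingD(1))
next
  case (Suc n)
  note PD = nonoverlappingD[OF Suc.prems(1)]
  have "P \<noteq> {}" using Suc.hyps(2) by auto
  then have "Max (snd ` P) \<in> snd ` P" using PD(1) by auto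
  then obtain c d where cd: "(c, d) \<in> P" and dM: "d = Max (snd ` P)" by auto
  have mx: "d' \<le> d" if "(c', d') \<in> P" for c' d'
    unfolding dM using PD(1) that by (intro Max_ge) (auto simp: rev_image_eqI)
  have "nonoverlapping a c (P - {(c, d)})"
    unfolding nonoverlapping_def
  proof (intro conjI)
    show "\<forall>(c', d')\<in>P - {(c, d)}. a \<le> c' \<and> c' < d' \<and> d' \<le> c"
      using PD(2) PD(3)[OF cd] mx by (fastforce)
    show "pairwise (\<lambda>(c, d) (c', d'). d \<le> c' \<or> d' \<le> c) (P - {(c, d)})"
      using Suc.prems(1) unfolding nonoverlapping_def by (meson Diff_subset pairwise_subset)
  qed (use PD(1) in auto)
  moreover have "n = card (P - {(c, d)})" using Suc.hyps(2) cd PD(1) by simp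
  ultimately have "(\<Sum>(c, d)\<in>P - {(c, d)}. s d - s c) \<le> s c - s a"
    using Suc.hyps(1) PD(2)[OF cd] by blast
  moreover have "(\<Sum>(c, d)\<in>P. s d - s c) = (s d - s c) + (\<Sum>(c, d)\<in>P - {(c, d)}. s d - s c)"
    using sum.remove[OF PD(1) cd, of "\<lambda>(c, d). s d - s c"] by simp
  ultimately show ?case using monoD[OF \<open>mono s\<close>, of d b] PD(2)[OF cd] by linarith
qed

lemma abs_cont_wrt_diff:
  assumes "abs_cont_wrt s u" "abs_cont_wrt s v"
  shows "abs_cont_wrt s (\<lambda>x. u x - v x)"
  unfolding abs_cont_wrt_iff
proof (intro allI impI)
  fix a b \<epsilon> :: real assume "\<epsilon> > 0"
  then have "\<epsilon> / 2 > 0" by simp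
  from abs_cont_wrtE[OF assms(1) this, of a b] obtain d1 where d1: "d1 > 0"
    "\<And>P. nonoverlapping a b P \<Longrightarrow> (\<Sum>(c, d) \<in> P. s d - s c) < d1 \<Longrightarrow> (\<Sum>(c, d) \<in> P. \<bar>u d - u c\<bar>) < \<epsilon>/2" by blast
  from abs_cont_wrtE[OF assms(2) \<open>\<epsilon> / 2 > 0\<close>, of a b] obtain d2 where d2: "d2 > 0"
    "\<And>P. nonoverlapping a b P \<Longrightarrow> (\<Sum>(c, d) \<in> P. s d - s c) < d2 \<Longrightarrow> (\<Sum>(c, d) \<in> P. \<bar>v d - v c\<bar>) < \<epsilon>/2" by blast
  show "\<exists>\<delta>>0. \<forall>P. nonoverlapping a b P \<longrightarrow> (\<Sum>(c, d)\<in>P. s d - s c) < \<delta> \<longrightarrow>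
        (\<Sum>(c, d)\<in>P. \<bar>u d - v d - (u c - v c)\<bar>) < \<epsilon>"
  proof (intro exI[of _ "min d1 d2"] conjI allI impI)
    fix P assume P: "nonoverlapping a b P" "(\<Sum>(c, d)\<in>P. s d - s c) < min d1 d2"
    have "(\<Sum>(c, d)\<in>P. \<bar>u d - v d - (u c - v c)\<bar>) \<le> (\<Sum>(c, d)\<in>P. \<bar>u d - u c\<bar>) + (\<Sum>(c, d)\<in>P. \<bar>v d - v c\<bar>)"
      unfolding sum.distrib[symmetric] by (rule sum_mono) auto
    then show "(\<Sum>(c, d)\<in>P. \<bar>u d - v d - (u c - v c)\<bar>) < \<epsilon>"
      using d1(2)[OF P(1)] d2(2)[OF P(1)] P(2) by simp
  qed (use d1 d2 in auto)
qed

lemma abs_cont_wrt_isCont: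
  assumes "abs_cont_wrt s u" "\<And>x. isCont s x"
  shows "isCont u x"
  unfolding continuous_at_eps_delta
proof (intro allI impI)
  fix \<epsilon> :: real assume "\<epsilon> > 0"
  from abs_cont_wrtE[OF assms(1) this, of "x-1" "x+1"] obtain \<delta> where \<delta>: "\<delta> > 0"
    "\<And>P. nonoverlapping (x-1) (x+1) P \<Longrightarrow> (\<Sum>(c, d) \<in> P. s d - s c) < \<delta> \<Longrightarrow> (\<Sum>(c, d) \<in> P. \<bar>u d - u c\<bar>) < \<epsilon>" by blast
  from assms(2)[of x] \<open>\<delta> > 0\<close> obtain d where d: "d > 0" "\<And>y. \<bar>y - x\<bar> < d \<Longrightarrow> \<bar>s y - s x\<bar> < \<delta>"
    unfolding continuous_at_eps_delta dist_real_def by blast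
  show "\<exists>d>0. \<forall>x'. dist x' x < d \<longrightarrow> dist (u x') (u x) < \<epsilon>"
  proof (intro exI[of _ "min d 1"] conjI allI impI)
    fix y assume y: "dist y x < min d 1"
    then have sy: "\<bar>s y - s x\<bar> < \<delta>" using d by (simp add: dist_real_def)
    consider "y = x" | "y < x" | "x < y" by linarith
    then show "dist (u y) (u x) < \<epsilon>"
    proof cases
      case 2
      then show ?thesis using \<delta>(2)[OF nonoverlapping_single[of _ y x]] y sy by (auto simp: dist_real_def abs_minus_commute)
    next
      case 3
      then show ?thesis using \<delta>(2)[OF nonoverlapping_single[of _ x y]] y sy by (auto simp: dist_real_def)
    qed (use \<open>\<epsilon> > 0\<close> in simp)
  qed (use d in simp)
qed

section \<open>Densities of monotone functions\<close>

text \<open>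
  A \<open>ds\<close>-null set inside \<open>[-m, m]\<close> lies in an open set of small \<open>ds\<close>-measure. A covering of the null set
  by nonoverlapping compact intervals inside this open set turns the epsilon-delta condition for finite families
  into a bound for its \<open>dp\<close>-measure.
\<close>
lemma absolutely_continuous_interval_measure:
  fixes s p :: "real \<Rightarrow> real"
  assumes s: "mono s" "\<And>x. isCont s x" and p: "mono p" "abs_cont_wrt s p"
  shows "absolutely_continuous (interval_measure s) (interval_measure p)"
  unfolding absolutely_continuous_def
proof
  let ?s = "interval_measure s" and ?p = "interval_measure p"
  have pc: "isCont p x" for x using abs_cont_wrt_isCont[OF p(2) s(2)] .
  have sIoc: "emeasure ?s {a<..b} = ennreal (s b - s a)" if "a \<le> b" for a b
    by (rule emeasure_interval_measure_Ioc) (use that s continuous_within_subset in \<open>auto simp: mono_def intro: continuous_at_imp_continuous_at_within\<close>)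
  have pIcc: "emeasure ?p {a..b} = ennreal (p b - p a)" if "a \<le> b" for a b
    by (rule emeasure_interval_measure_Icc) (use that p pc in \<open>auto simp: mono_def intro: continuous_at_imp_continuous_on\<close>)
  fix N assume N: "N \<in> null_sets ?s"
  have "N \<inter> {-real (Suc n)..real (Suc n)} \<in> null_sets ?p" for n
  proof -
    define m where "m = real (Suc n)"
    have "m > 0" by (simp add: m_def)
    define A where "A = N \<inter> {-m..m}"
    have A: "A \<in> null_sets ?s" unfolding A_def using N by (intro null_set_Int2) auto
    have "measure ?p A \<le> \<epsilon>" if eps: "\<epsilon> > 0" for \<epsilon>
    proof -
      obtain \<delta> where \<delta>: "\<delta> > 0"
        "\<And>P. nonoverlapping (-m) m P \<Longrightarrow> (\<Sum>(c, d) \<in> P. s d - s c) < \<delta> \<Longrightarrow> (\<Sum>(c, d) \<in> P. \<bar>p d - p c\<bar>) < \<epsilon>"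
        using abs_cont_wrtE[OF p(2) eps, of "-m" m] by blast
      \<comment> \<open>The restriction of \<open>ds\<close> to \<open>[-m, m]\<close> is finite, hence outer regular.\<close>
      define M where "M = density ?s (indicator {-m..m})"
      have Mem: "emeasure M B = emeasure ?s (B \<inter> {-m..m})" if "B \<in> sets borel" for B
        unfolding M_def using that by (subst emeasure_density) (auto simp: nn_integral_indicator indicator_inter_arith[symmetric] Int_commute mult.commute)
      have "emeasure ?s {-m..m} \<le> emeasure ?s {-m-1<..m}" by (rule emeasure_mono) auto
      also have "\<dots> < \<infinity>" using \<open>m > 0\<close> by (subst sIoc) auto
      finally have "emeasure M (space M) \<noteq> \<infinity>" using Mem[of UNIV] by (simp add: M_def)
      moreover have "sets M = sets borel" by (simp add: M_def)
      moreover have "A \<in> sets borel" using A by (simp add: null_sets_def)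
      ultimately have "emeasure M A = (INF U \<in> {U. A \<subseteq> U \<and> open U}. emeasure M U)"
        using outer_regular[of M A] by blast
      moreover have "emeasure M A = 0" using A Mem[of A] unfolding A_def
        by (auto simp: null_sets_def Int_assoc)
      ultimately have "(INF U \<in> {U. A \<subseteq> U \<and> open U}. emeasure M U) < ennreal \<delta>" using \<open>\<delta> > 0\<close> by simp
      then obtain U where U: "A \<subseteq> U" "open U" "emeasure M U < ennreal \<delta>" by (auto simp: INF_less_iff)
      have g: "gauge (\<lambda>x. if x \<in> A then U else UNIV)" using U by (auto simp: gauge_def)
      have Am: "A \<subseteq> cbox (-m) m" and ne: "box (-m) m \<noteq> {}" using \<open>m > 0\<close> by (auto simp: A_def)
      obtain D where D: "countable D" "\<Union>D \<subseteq> cbox (-m) m"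
        "\<And>K. K \<in> D \<Longrightarrow> interior K \<noteq> {} \<and> (\<exists>c d. K = cbox c d)"
        "pairwise (\<lambda>A B. interior A \<inter> interior B = {}) D"
        "\<And>K. K \<in> D \<Longrightarrow> \<exists>x \<in> A \<inter> K. K \<subseteq> (if x \<in> A then U else UNIV)" "A \<subseteq> \<Union>D"
        by (rule covering_lemma[OF Am ne g]) (rule that)
      have Dab: "\<exists>c d. c < d \<and> K = {c..d}" if K: "K \<in> D" for K
      proof -
        obtain c d where "K = {c..d}" using D(3)[OF K] by auto
        moreover from this have "c < d" using D(3)[OF K] by (auto simp: interior_atLeastAtMost_real)
        ultimately show ?thesis by blast
      qed
      then obtain lo hi where lh: "\<And>K. K \<in> D \<Longrightarrow> lo K < hi K \<and> K = {lo K..hi K}" by metis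
      have bnd: "measure ?p (\<Union>K\<in>F. K) \<le> \<epsilon>" if F: "F \<subseteq> D" "finite F" for F
      proof -
        define P where "P = (\<lambda>K. (lo K, hi K)) ` F"
        have inj: "inj_on (\<lambda>K. (lo K, hi K)) F"
          by (rule inj_onI) (metis F(1) lh prod.inject subsetD)
        have lt: "lo K < hi K" and Keq: "K = {lo K..hi K}" if "K \<in> F" for K
          using lh[of K] F that by auto
        have sep: "hi K \<le> lo L \<or> hi L \<le> lo K" if "K \<in> F" "L \<in> F" "K \<noteq> L" for K L
        proof -
          have "interior K \<inter> interior L = {}" using D(4) F that unfolding pairwise_def by blast
          moreover have "interior K = {lo K<..<hi K}" "interior L = {lo L<..<hi L}"
            using lh[of K] lh[of L] that F by (metis interior_atLeastAtMost_real subsetD)+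
          ultimately show ?thesis using lh[of K] lh[of L] that F
            by (auto simp: min_le_iff_disj le_max_iff_disj)
        qed
        have KU: "K \<subseteq> U \<inter> {-m..m}" if "K \<in> F" for K
          using D(5)[of K] D(2) that F by fastforce
        have P: "nonoverlapping (-m) m P"
          unfolding nonoverlapping_def
        proof (intro conjI)
          show "\<forall>(c, d)\<in>P. - m \<le> c \<and> c < d \<and> d \<le> m"
            unfolding P_def
          proof clarsimp
            fix K assume "K \<in> F"
            then have "lo K < hi K" "K \<subseteq> {-m..m}" using lt KU by auto
            moreover from this have "{lo K..hi K} \<subseteq> {-m..m}" using Keq[OF \<open>K \<in> F\<close>] by metis
            ultimately show "-m \<le> lo K \<and> lo K < hi K \<and> hi K \<le> m" by auto
          qed
          show "pairwise (\<lambda>(c, d) (c', d'). d \<le> c' \<or> d' \<le> c) P"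
            unfolding P_def pairwise_def using sep by fastforce
        qed (simp add: P_def F)
        have "ennreal (\<Sum>(c, d) \<in> P. s d - s c) = (\<Sum>K\<in>F. ennreal (s (hi K) - s (lo K)))"
          unfolding P_def using monoD[OF s(1)] lt
          by (subst sum.reindex[OF inj], simp, subst sum_ennreal) (auto simp: less_imp_le)
        also have "\<dots> = (\<Sum>K\<in>F. emeasure ?s {lo K<..hi K})"
          by (rule sum.cong) (use lt in \<open>auto simp: sIoc less_imp_le\<close>)
        also have "\<dots> = emeasure ?s (\<Union>K\<in>F. {lo K<..hi K})"
        proof (rule sum_emeasure)
          show "disjoint_family_on (\<lambda>K. {lo K<..hi K}) F"
            unfolding disjoint_family_on_def using sep by fastforce
        qed (use F in auto)
        also have "\<dots> \<le> emeasure ?s (U \<inter> {-m..m})"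
        proof (rule emeasure_mono)
          show "(\<Union>K\<in>F. {lo K<..hi K}) \<subseteq> U \<inter> {- m..m}"
          proof
            fix x assume "x \<in> (\<Union>K\<in>F. {lo K<..hi K})"
            then obtain K where K: "K \<in> F" "x \<in> {lo K..hi K}" by auto
            then have "x \<in> K" using Keq[OF K(1)] by metis
            then show "x \<in> U \<inter> {- m..m}" using KU[OF K(1)] by blast
          qed
        qed (use U in auto)
        also have "\<dots> < ennreal \<delta>" using U(2,3) Mem[of U] by auto
        finally have "(\<Sum>(c, d) \<in> P. s d - s c) < \<delta>" 
          by (meson ennreal_leI not_le)
        from \<delta>(2)[OF P this] have "(\<Sum>K\<in>F. \<bar>p (hi K) - p (lo K)\<bar>) < \<epsilon>"
          unfolding P_def by (simp add: sum.reindex[OF inj])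
        moreover have "measure ?p (\<Union>K\<in>F. K) \<le> (\<Sum>K\<in>F. measure ?p K)"
          by (rule measure_UNION_le) (use F Keq in \<open>simp_all, metis atLeastAtMost_borel\<close>)
        moreover have "(\<Sum>K\<in>F. measure ?p K) = (\<Sum>K\<in>F. \<bar>p (hi K) - p (lo K)\<bar>)"
        proof (rule sum.cong)
          fix K assume "K \<in> F"
          then have "lo K < hi K" "K = {lo K..hi K}" using lt Keq by blast+
          moreover have "p (lo K) \<le> p (hi K)" using p(1) \<open>lo K < hi K\<close> by (auto simp: mono_def)
          ultimately show "measure ?p K = \<bar>p (hi K) - p (lo K)\<bar>"
            using pIcc[of "lo K" "hi K"] by (simp add: measure_def)
        qed simp
        ultimately show ?thesis by linarith
      qed
      have Dfm: "K \<in> fmeasurable ?p" if "K \<in> D" for K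
        using lh[OF that] pIcc[of "lo K" "hi K"] by (intro fmeasurableI) (metis atLeastAtMost_borel sets_interval_measure, metis ennreal_less_top infinity_ennreal_def less_imp_le)
      have "measure ?p A \<le> measure ?p (\<Union>K\<in>D. K)"
        by (rule measure_mono_fmeasurable) (use D A fmeasurable_UN_bound[OF \<open>countable D\<close> Dfm bnd] in \<open>auto simp: null_sets_def\<close>)
      also have "\<dots> \<le> \<epsilon>" using measure_UN_bound[OF \<open>countable D\<close> Dfm bnd] .
      finally show ?thesis .
    qed
    then have "measure ?p A = 0" by (meson dual_order.antisym field_le_epsilon measure_nonneg add_0 field_lbound_gt_zero linorder_not_less le_less_trans)
    moreover have "emeasure ?p A \<noteq> \<infinity>"
    proof -
      have "emeasure ?p A \<le> emeasure ?p {-m..m}" by (rule emeasure_mono) (auto simp: A_def)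
      also have "\<dots> < \<infinity>" using \<open>m > 0\<close> by (subst pIcc) auto
      finally show ?thesis by simp
    qed
    ultimately have "emeasure ?p A = 0" by (simp add: measure_def enn2real_eq_0_iff)
    then show ?thesis using A by (auto simp: null_sets_def A_def m_def)
  qed
  then have "(\<Union>n. N \<inter> {-real (Suc n)..real (Suc n)}) \<in> null_sets ?p" by (intro null_sets_UN) auto
  moreover have "(\<Union>n. N \<inter> {-real (Suc n)..real (Suc n)}) = N"
  proof -
    have "\<exists>n. -real (Suc n) \<le> x \<and> x \<le> real (Suc n)" for x
      using reals_Archimedean2[of "\<bar>x\<bar>"] by (metis abs_le_D1 abs_le_D2 lessI less_eq_real_def less_trans minus_le_iff of_nat_less_iff)
    then show ?thesis by auto
  qed
  ultimately show "N \<in> null_sets ?p" by simp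
qed

lemma is_ds_density_diff:
  assumes "is_ds_density s u h" "is_ds_density s v k"
  shows "is_ds_density s (\<lambda>x. u x - v x) (\<lambda>x. h x - k x)"
  unfolding is_ds_density_def
proof (intro conjI allI impI)
  fix a b :: real assume "a \<le> b"
  then have i: "set_integrable (interval_measure s) {a<..b} h" "set_integrable (interval_measure s) {a<..b} k"
    and e: "u b - u a = (LINT x:{a<..b}|interval_measure s. h x)" "v b - v a = (LINT x:{a<..b}|interval_measure s. k x)"
    using assms unfolding is_ds_density_def by blast+
  show "set_integrable (interval_measure s) {a<..b} (\<lambda>x. h x - k x)" using i by (rule set_integral_diff)
  show "u b - v b - (u a - v a) = (LINT x:{a<..b}|interval_measure s. h x - k x)"
    using set_integral_diff(2)[OF i] e by linarith
qed (use assms in \<open>auto simp: is_ds_density_def\<close>)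

text \<open>
  The Radon-Nikodym theorem for \<open>dp \<lless> ds\<close>. The measure identity is kept along with the density, because it
  is what identifies \<open>ds\<close> itself when the reference function is the identity.
\<close>
lemma mono_density_exists:
  fixes s p :: "real \<Rightarrow> real"
  assumes s: "mono s" "\<And>x. isCont s x" and p: "mono p" "abs_cont_wrt s p"
  obtains h where "is_ds_density s p h" "\<And>x. 0 \<le> h x"
    "density (interval_measure s) (\<lambda>x. ennreal (h x)) = interval_measure p"
proof -
  let ?s = "interval_measure s" and ?p = "interval_measure p"
  have pc: "isCont p x" for x using abs_cont_wrt_isCont[OF p(2) s(2)] .
  interpret sigma_finite_measure ?s
    by (rule sigma_finite_interval_measure) (use s in \<open>auto simp: mono_def intro: continuous_at_imp_continuous_at_within\<close>)
  obtain f where f: "f \<in> borel_measurable ?s" "density ?s f = ?p"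
    using Radon_Nikodym[OF absolutely_continuous_interval_measure[OF assms]] by auto
  have pIoc: "emeasure ?p {a<..b} = ennreal (p b - p a)" if "a \<le> b" for a b
    by (rule emeasure_interval_measure_Ioc) (use that p pc in \<open>auto simp: mono_def intro: continuous_at_imp_continuous_at_within\<close>)
  have eq: "(\<integral>\<^sup>+ x. f x * indicator {a<..b} x \<partial>?s) = ennreal (p b - p a)" if "a \<le> b" for a b
    using pIoc[OF that] f by (subst emeasure_density[symmetric]) auto
  have fin: "AE x in ?s. f x * indicator {a<..b} x \<noteq> \<infinity>" if "a \<le> b" for a b
    by (rule nn_integral_PInf_AE) (use f eq[OF that] in auto)
  have "AE x in ?s. \<forall>n. f x * indicator {-real n<..real n} x \<noteq> \<infinity>"
    unfolding AE_all_countable by (intro allI fin) simp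
  then have finite: "AE x in ?s. f x = ennreal (enn2real (f x))"
  proof eventually_elim
    case (elim x)
    obtain n where "\<bar>x\<bar> < real n" using reals_Archimedean2 by blast
    then have "- real n < x" "x \<le> real n" by linarith+
    then show ?case using elim[rule_format, of n] by (simp add: less_top)
  qed
  have "has_bochner_integral ?s (\<lambda>x. indicator {a<..b} x *\<^sub>R enn2real (f x)) (p b - p a)" if "a \<le> b" for a b
  proof (rule has_bochner_integral_nn_integral)
    have "(\<integral>\<^sup>+ x. ennreal (indicator {a<..b} x *\<^sub>R enn2real (f x)) \<partial>?s) = (\<integral>\<^sup>+ x. f x * indicator {a<..b} x \<partial>?s)"
      using finite by (intro nn_integral_cong_AE) (auto elim!: eventually_mono simp: indicator_def)
    then show "(\<integral>\<^sup>+ x. ennreal (indicator {a<..b} x *\<^sub>R enn2real (f x)) \<partial>?s) = ennreal (p b - p a)"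
      using eq[OF that] by simp
    show "0 \<le> p b - p a" using monoD[OF p(1) that] by simp
  qed (use f in auto)
  then have "is_ds_density s p (\<lambda>x. enn2real (f x))"
    using f unfolding is_ds_density_def set_integrable_def set_lebesgue_integral_def
    by (auto simp: has_bochner_integral_iff)
  moreover have "density ?s (\<lambda>x. ennreal (enn2real (f x))) = ?p"
    unfolding f(2)[symmetric] by (rule density_cong) (use f finite in \<open>auto elim: eventually_mono\<close>)
  ultimately show thesis using that by auto
qed

section \<open>Positive variation and the existence of densities\<close>

definition positive_variation :: "(real \<Rightarrow> real) \<Rightarrow> real \<Rightarrow> real \<Rightarrow> real" where
  "positive_variation u a b = (SUP P\<in>Collect (nonoverlapping a b). \<Sum>(c, d)\<in>P. u d - u c)"

text \<open>
  Near every point \<open>s\<close> varies by less than the \<open>\<delta>\<close> that belongs to \<open>\<epsilon> = 1\<close>, so the sums of increments are locally bounded by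
  \<open>1\<close>; bisection makes the bound global.
\<close>
lemma bdd_above_increments:
  fixes s u :: "real \<Rightarrow> real"
  assumes s: "mono s" "\<And>x. isCont s x" and u: "abs_cont_wrt s u" and "a \<le> b"
  shows "bdd_above ((\<lambda>P. \<Sum>(c, d)\<in>P. u d - u c) ` Collect (nonoverlapping a b))"
proof -
  have "\<exists>B. \<forall>P. nonoverlapping a b P \<longrightarrow> (\<Sum>(c, d)\<in>P. u d - u c) \<le> B"
    using \<open>a \<le> b\<close>
  proof (induction rule: Bolzano)
    case (trans a b c)
    then obtain B1 B2 where B: "\<And>P. nonoverlapping a b P \<Longrightarrow> (\<Sum>(c, d)\<in>P. u d - u c) \<le> B1"
      "\<And>P. nonoverlapping b c P \<Longrightarrow> (\<Sum>(c, d)\<in>P. u d - u c) \<le> B2" by metis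
    show ?case
    proof (intro exI[of _ "B1 + B2"] allI impI)
      fix P assume "nonoverlapping a c P"
      then show "(\<Sum>(c, d)\<in>P. u d - u c) \<le> B1 + B2"
        by (rule nonoverlapping_split[OF _ trans(3,4)]) (use B in \<open>simp add: add_mono\<close>)
    qed
  next
    case (local x)
    obtain \<delta> where \<delta>: "\<delta> > 0" "\<And>P. nonoverlapping (x-1) (x+1) P \<Longrightarrow>
        (\<Sum>(c, d) \<in> P. s d - s c) < \<delta> \<Longrightarrow> (\<Sum>(c, d) \<in> P. \<bar>u d - u c\<bar>) < 1"
      using abs_cont_wrtE[OF u zero_less_one, of "x-1" "x+1"] by blast
    obtain \<eta> where \<eta>: "\<eta> > 0" "\<And>y. \<bar>y - x\<bar> < \<eta> \<Longrightarrow> \<bar>s y - s x\<bar> < \<delta>/2"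
      using s(2)[of x] half_gt_zero[OF \<open>\<delta> > 0\<close>] unfolding continuous_at_eps_delta dist_real_def by blast
    show ?case
    proof (rule exI[of _ "min \<eta> 1"], intro conjI allI impI)
      fix a b assume ab: "a \<le> x \<and> x \<le> b \<and> b - a < min \<eta> 1"
      show "\<exists>B. \<forall>P. nonoverlapping a b P \<longrightarrow> (\<Sum>(c, d)\<in>P. u d - u c) \<le> B"
      proof (rule exI[of _ 1], intro allI impI)
        fix P assume P: "nonoverlapping a b P"
        have "(\<Sum>(c, d) \<in> P. s d - s c) \<le> s b - s a"
          using sum_increments_le[OF s(1) P] ab by simp
        also have "\<dots> < \<delta>" using \<eta>(2)[of a] \<eta>(2)[of b] ab by linarith
        finally have "(\<Sum>(c, d) \<in> P. \<bar>u d - u c\<bar>) < 1"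
          using \<delta>(2) nonoverlapping_mono[OF P, of "x-1" "x+1"] ab by auto
        moreover have "(\<Sum>(c, d) \<in> P. u d - u c) \<le> (\<Sum>(c, d) \<in> P. \<bar>u d - u c\<bar>)"
          by (rule sum_mono) auto
        ultimately show "(\<Sum>(c, d) \<in> P. u d - u c) \<le> 1" by linarith
      qed
    qed (use \<eta> in auto)
  qed
  then show ?thesis by (auto simp: bdd_above_def)
qed

lemma positive_variation_upper:
  assumes "mono s" "\<And>x. isCont s x" "abs_cont_wrt s u" "a \<le> b" "nonoverlapping a b P"
  shows "(\<Sum>(c, d)\<in>P. u d - u c) \<le> positive_variation u a b"
  unfolding positive_variation_def
  by (rule cSUP_upper) (use assms(5) bdd_above_increments[OF assms(1-4)] in auto)

lemma positive_variation_least: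
  assumes "\<And>P. nonoverlapping a b P \<Longrightarrow> (\<Sum>(c, d)\<in>P. u d - u c) \<le> B"
  shows "positive_variation u a b \<le> B"
  unfolding positive_variation_def
  by (rule cSUP_least) (use assms nonoverlapping_empty in auto)

lemma positive_variation_add:
  assumes s: "mono s" "\<And>x. isCont s x" and u: "abs_cont_wrt s u" and "a \<le> b" "b \<le> c"
  shows "positive_variation u a b + positive_variation u b c = positive_variation u a c"
proof (rule antisym)
  note upper = positive_variation_upper[OF s u]
  have "positive_variation u a b \<le> positive_variation u a c - positive_variation u b c"
  proof (rule positive_variation_least)
    fix P assume P: "nonoverlapping a b P"
    have "positive_variation u b c \<le> positive_variation u a c - (\<Sum>(c, d)\<in>P. u d - u c)"
    proof (rule positive_variation_least)
      fix Q assume Q: "nonoverlapping b c Q"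
      note PQ = nonoverlapping_append[OF P Q \<open>a \<le> b\<close> \<open>b \<le> c\<close>]
      have "(\<Sum>(c, d)\<in>P. u d - u c) + (\<Sum>(c, d)\<in>Q. u d - u c) = (\<Sum>(c, d)\<in>P \<union> Q. u d - u c)"
        using nonoverlappingD(1)[OF P] nonoverlappingD(1)[OF Q] PQ(2) by (simp add: sum.union_disjoint)
      also have "\<dots> \<le> positive_variation u a c" using upper[OF _ PQ(1)] assms(4,5) by simp
      finally show "(\<Sum>(c, d)\<in>Q. u d - u c) \<le> positive_variation u a c - (\<Sum>(c, d)\<in>P. u d - u c)" by simp
    qed
    then show "(\<Sum>(c, d)\<in>P. u d - u c) \<le> positive_variation u a c - positive_variation u b c" by simp
  qed
  then show "positive_variation u a b + positive_variation u b c \<le> positive_variation u a c" by simp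
  show "positive_variation u a c \<le> positive_variation u a b + positive_variation u b c"
  proof (rule positive_variation_least)
    fix P assume "nonoverlapping a c P"
    then show "(\<Sum>(c, d)\<in>P. u d - u c) \<le> positive_variation u a b + positive_variation u b c"
      by (rule nonoverlapping_split[OF _ assms(4,5)]) (use upper assms(4,5) in \<open>simp add: add_mono\<close>)
  qed
qed

text \<open>
  The Jordan decomposition. Since the positive variation of \<open>u\<close> is additive over adjacent intervals, it is the increment of
  an increasing function \<open>p\<close>. To bound the variation of \<open>p\<close> over a family, refine each interval by a family
  that nearly attains the supremum: the \<open>s\<close>-length does not grow, so the condition for \<open>u\<close> applies to the refinement.
\<close>
lemma abs_cont_wrt_mono_decomposition:
  fixes s u :: "real \<Rightarrow> real"
  assumes s: "mono s" "\<And>x. isCont s x" and u: "abs_cont_wrt s u"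
  obtains p where "mono p" "abs_cont_wrt s p" "mono (\<lambda>x. p x - u x)"
proof -
  \<comment> \<open>The base point 0 fixes the additive constant, with the sign convention of an oriented integral.\<close>
  define p where "p x = (if 0 \<le> x then positive_variation u 0 x else - positive_variation u x 0)" for x
  have diff: "p y - p x = positive_variation u x y" if "x \<le> y" for x y
    using that positive_variation_add[OF s u, of 0 x y] positive_variation_add[OF s u, of x 0 y]
      positive_variation_add[OF s u, of x y 0] by (auto simp: p_def)
  have nonneg: "0 \<le> positive_variation u x y" if "x \<le> y" for x y
    using positive_variation_upper[OF s u that nonoverlapping_empty] by simp
  have ge: "u y - u x \<le> positive_variation u x y" if "x < y" for x y
    using positive_variation_upper[OF s u _ nonoverlapping_single[of x x y y]] that by simp
  show thesis
  proof
    show "mono p"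
    proof (rule monoI)
      fix x y :: real assume "x \<le> y" then show "p x \<le> p y" using diff nonneg by fastforce
    qed
    show "mono (\<lambda>x. p x - u x)"
    proof (rule monoI)
      fix x y :: real assume "x \<le> y"
      then show "p x - u x \<le> p y - u y" using diff[of x y] ge[of x y] by (cases "x = y") auto
    qed
    show "abs_cont_wrt s p"
      unfolding abs_cont_wrt_iff
    proof (intro allI impI)
      fix a b \<epsilon> :: real assume "\<epsilon> > 0"
      then obtain \<delta> where \<delta>: "\<delta> > 0" "\<And>P. nonoverlapping a b P \<Longrightarrow>
          (\<Sum>(c, d) \<in> P. s d - s c) < \<delta> \<Longrightarrow> (\<Sum>(c, d) \<in> P. \<bar>u d - u c\<bar>) < \<epsilon>/2"
        using abs_cont_wrtE[OF u half_gt_zero, of \<epsilon> a b] by blast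
      show "\<exists>\<delta>>0. \<forall>P. nonoverlapping a b P \<longrightarrow> (\<Sum>(c, d) \<in> P. s d - s c) < \<delta> \<longrightarrow> (\<Sum>(c, d) \<in> P. \<bar>p d - p c\<bar>) < \<epsilon>"
      proof (intro exI[of _ \<delta>] conjI allI impI)
        fix P assume P: "nonoverlapping a b P" and small: "(\<Sum>(c, d) \<in> P. s d - s c) < \<delta>"
        note PD = nonoverlappingD[OF P]
        \<comment> \<open>Half of \<open>\<epsilon>\<close> is spent on \<open>u\<close>, the other half on missing the supremum once per interval.\<close>
        define \<eta> where "\<eta> = \<epsilon> / (2 * (real (card P) + 1))"
        have "\<eta> > 0" using \<open>\<epsilon> > 0\<close> by (simp add: \<eta>_def)
        have "\<exists>Q. nonoverlapping (fst i) (snd i) Q \<and> positive_variation u (fst i) (snd i) - \<eta> \<le> (\<Sum>(c, d)\<in>Q. u d - u c)" for i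
          using positive_variation_least[of "fst i" "snd i" u "positive_variation u (fst i) (snd i) - \<eta>"] \<open>\<eta> > 0\<close>
          by (smt (verit))
        then obtain Q where Q: "\<And>i. nonoverlapping (fst i) (snd i) (Q i)"
          "\<And>i. positive_variation u (fst i) (snd i) - \<eta> \<le> (\<Sum>(c, d)\<in>Q i. u d - u c)" by metis
        note ref = nonoverlapping_refine[OF P Q(1)]
        have U: "(\<Sum>(c, d)\<in>(\<Union>i\<in>P. Q i). g c d) = (\<Sum>i\<in>P. \<Sum>(c, d)\<in>Q i. g c d)" for g :: "real \<Rightarrow> real \<Rightarrow> real"
          by (rule sum.UNION_disjoint) (use PD(1) nonoverlappingD(1)[OF Q(1)] ref(2) in auto)
        have "(\<Sum>(c, d)\<in>(\<Union>i\<in>P. Q i). s d - s c) \<le> (\<Sum>i\<in>P. s (snd i) - s (fst i))"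
          unfolding U using sum_increments_le[OF s(1) Q(1)] PD(2) by (intro sum_mono) (force simp: less_imp_le)
        also have "\<dots> < \<delta>" using small by (simp add: split_beta)
        finally have "(\<Sum>(c, d)\<in>(\<Union>i\<in>P. Q i). \<bar>u d - u c\<bar>) < \<epsilon>/2" using \<delta>(2)[OF ref(1)] by blast
        moreover have "(\<Sum>(c, d) \<in> P. \<bar>p d - p c\<bar>) = (\<Sum>i\<in>P. positive_variation u (fst i) (snd i))"
          by (rule sum.cong) (use PD(2) diff nonneg in \<open>force simp: less_imp_le\<close>)+
        moreover have "\<dots> \<le> (\<Sum>i\<in>P. (\<Sum>(c, d)\<in>Q i. \<bar>u d - u c\<bar>) + \<eta>)"
        proof (rule sum_mono)
          fix i
          have "(\<Sum>(c, d)\<in>Q i. u d - u c) \<le> (\<Sum>(c, d)\<in>Q i. \<bar>u d - u c\<bar>)" by (rule sum_mono) auto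
          then show "positive_variation u (fst i) (snd i) \<le> (\<Sum>(c, d)\<in>Q i. \<bar>u d - u c\<bar>) + \<eta>"
            using Q(2)[of i] by linarith
        qed
        moreover have "(\<Sum>i\<in>P. (\<Sum>(c, d)\<in>Q i. \<bar>u d - u c\<bar>) + \<eta>) = (\<Sum>(c, d)\<in>(\<Union>i\<in>P. Q i). \<bar>u d - u c\<bar>) + real (card P) * \<eta>"
          unfolding U by (simp add: sum.distrib)
        moreover have "real (card P) * \<eta> \<le> \<epsilon> / 2"
          using \<open>\<epsilon> > 0\<close> by (simp add: \<eta>_def field_simps)
        ultimately show "(\<Sum>(c, d) \<in> P. \<bar>p d - p c\<bar>) < \<epsilon>" by linarith
      qed (rule \<delta>)
    qed
  qed
qed

theorem abs_cont_wrt_density_exists: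
  fixes s u :: "real \<Rightarrow> real"
  assumes s: "mono s" "\<And>x. isCont s x" and u: "abs_cont_wrt s u"
  shows "\<exists>h. is_ds_density s u h"
proof -
  obtain p where p: "mono p" "abs_cont_wrt s p" "mono (\<lambda>x. p x - u x)"
    using abs_cont_wrt_mono_decomposition[OF assms] .
  obtain h where "is_ds_density s p h" using mono_density_exists[OF s p(1,2)] .
  moreover obtain k where "is_ds_density s (\<lambda>x. p x - u x) k"
    using mono_density_exists[OF s p(3) abs_cont_wrt_diff[OF p(2) u]] .
  ultimately show ?thesis using is_ds_density_diff[of s p h "\<lambda>x. p x - u x" k] by auto
qed

section \<open>Absolutely continuous functions on the line\<close>

lemma set_integrable_Ioc_has_integral:
  fixes h :: "real \<Rightarrow> real"
  assumes "set_integrable lborel {a<..b} h"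
  shows "(h has_integral (LINT x:{a<..b}|lborel. h x)) {a..b}"
proof -
  have "(h has_integral (LINT x:{a<..b}|lborel. h x)) {a<..b}"
    using set_borel_integral_eq_integral[OF assms] by (simp add: has_integral_integral)
  then show ?thesis
    by (rule has_integral_spike_set_eq[THEN iffD1, rotated 2]) (auto intro: negligible_subset[of "{a}"])
qed

lemma is_ds_density_id_AE_derivative:
  assumes "is_ds_density (\<lambda>x. x) u h"
  shows "AE x in lebesgue. (u has_real_derivative h x) (at x)"
proof (rule AE_has_real_derivative_of_has_integral)
  fix a b :: real assume "a \<le> b"
  then show "(h has_integral u b - u a) {a..b}"
    using assms set_integrable_Ioc_has_integral[of a b h] unfolding is_ds_density_def lborel_eq_real[symmetric] by auto
qed

text \<open>
  The fundamental theorem for absolutely continuous functions: such a function is an indefinite integral, and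
  the differentiation theorem identifies the integrand with the derivative almost everywhere.
\<close>
lemma abs_cont_FTC:
  assumes "abs_cont u" "a \<le> b"
  shows "(deriv u has_integral u b - u a) {a..b}"
proof -
  obtain h where h: "is_ds_density (\<lambda>x. x) u h"
    using abs_cont_wrt_density_exists[of "\<lambda>x. x" u] assms(1) by (auto simp: abs_cont_def mono_def)
  have ae: "AE x in lebesgue. h x = deriv u x"
    using is_ds_density_id_AE_derivative[OF h] by eventually_elim (simp add: DERIV_imp_deriv)
  have "(h has_integral u b - u a) {a..b}"
    using h set_integrable_Ioc_has_integral[of a b h] \<open>a \<le> b\<close> unfolding is_ds_density_def lborel_eq_real[symmetric] by auto
  moreover have "negligible {x. \<not> h x = deriv u x}" using ae by (simp only: AE_lebesgue_iff_negligible)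
  ultimately show ?thesis by (elim has_integral_spike[rotated 2]) auto
qed

lemma abs_cont_trans:
  assumes "abs_cont s" "abs_cont_wrt s v"
  shows "abs_cont v"
  unfolding abs_cont_def abs_cont_wrt_iff
proof (intro allI impI)
  fix a b \<epsilon> :: real assume "\<epsilon> > 0"
  from abs_cont_wrtE[OF assms(2) this, of a b] obtain d1 where d1: "d1 > 0"
    "\<And>P. nonoverlapping a b P \<Longrightarrow> (\<Sum>(c, d) \<in> P. s d - s c) < d1 \<Longrightarrow> (\<Sum>(c, d) \<in> P. \<bar>v d - v c\<bar>) < \<epsilon>" by blast
  from abs_cont_wrtE[OF assms(1)[unfolded abs_cont_def] d1(1), of a b] obtain d2 where d2: "d2 > 0"
    "\<And>P. nonoverlapping a b P \<Longrightarrow> (\<Sum>(c, d) \<in> P. d - c) < d2 \<Longrightarrow> (\<Sum>(c, d) \<in> P. \<bar>s d - s c\<bar>) < d1" by blast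
  have "(\<Sum>(c, d) \<in> P. s d - s c) \<le> (\<Sum>(c, d) \<in> P. \<bar>s d - s c\<bar>)" for P
    by (rule sum_mono) auto
  then show "\<exists>\<delta>>0. \<forall>P. nonoverlapping a b P \<longrightarrow> (\<Sum>(c, d) \<in> P. d - c) < \<delta> \<longrightarrow> (\<Sum>(c, d) \<in> P. \<bar>v d - v c\<bar>) < \<epsilon>"
    using d1 d2 by (meson le_less_trans)
qed

lemma abs_cont_mult:
  assumes f: "abs_cont f" and g: "abs_cont g"
  shows "abs_cont (\<lambda>x. f x * g x)"
  unfolding abs_cont_def abs_cont_wrt_iff
proof (intro allI impI)
  fix a b \<epsilon> :: real assume "\<epsilon> > 0"
  have "continuous_on {a..b} f" "continuous_on {a..b} g"
    using abs_cont_wrt_isCont[of "\<lambda>x. x"] f g unfolding abs_cont_def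
    by (auto intro!: continuous_at_imp_continuous_on)
  then have "bounded (f ` {a..b})" "bounded (g ` {a..b})"
    by (auto intro: compact_imp_bounded compact_continuous_image)
  then obtain M N where MN: "M > 0" "\<And>x. x \<in> {a..b} \<Longrightarrow> \<bar>f x\<bar> \<le> M" "N > 0" "\<And>x. x \<in> {a..b} \<Longrightarrow> \<bar>g x\<bar> \<le> N"
    unfolding bounded_pos by auto
  have "\<epsilon> / (2 * N) > 0" "\<epsilon> / (2 * M) > 0" using MN \<open>\<epsilon> > 0\<close> by auto
  from abs_cont_wrtE[OF f[unfolded abs_cont_def] this(1), of a b] obtain d1 where d1: "d1 > 0"
    "\<And>P. nonoverlapping a b P \<Longrightarrow> (\<Sum>(c, d) \<in> P. d - c) < d1 \<Longrightarrow> (\<Sum>(c, d) \<in> P. \<bar>f d - f c\<bar>) < \<epsilon> / (2 * N)" by blast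
  from abs_cont_wrtE[OF g[unfolded abs_cont_def] \<open>\<epsilon> / (2 * M) > 0\<close>, of a b] obtain d2 where d2: "d2 > 0"
    "\<And>P. nonoverlapping a b P \<Longrightarrow> (\<Sum>(c, d) \<in> P. d - c) < d2 \<Longrightarrow> (\<Sum>(c, d) \<in> P. \<bar>g d - g c\<bar>) < \<epsilon> / (2 * M)" by blast
  show "\<exists>\<delta>>0. \<forall>P. nonoverlapping a b P \<longrightarrow> (\<Sum>(c, d) \<in> P. d - c) < \<delta> \<longrightarrow> (\<Sum>(c, d) \<in> P. \<bar>f d * g d - f c * g c\<bar>) < \<epsilon>"
  proof (intro exI[of _ "min d1 d2"] conjI allI impI)
    fix P assume P: "nonoverlapping a b P" "(\<Sum>(c, d) \<in> P. d - c) < min d1 d2"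
    have "(\<Sum>(c, d) \<in> P. \<bar>f d * g d - f c * g c\<bar>) \<le> (\<Sum>(c, d) \<in> P. N * \<bar>f d - f c\<bar> + M * \<bar>g d - g c\<bar>)"
    proof (rule sum_mono, clarify)
      fix c d assume "(c, d) \<in> P"
      then have cd: "c \<in> {a..b}" "d \<in> {a..b}" using nonoverlappingD(2)[OF P(1)] by force+
      have "f d * g d - f c * g c = g d * (f d - f c) + f c * (g d - g c)" by (simp add: algebra_simps)
      then have "\<bar>f d * g d - f c * g c\<bar> \<le> \<bar>g d\<bar> * \<bar>f d - f c\<bar> + \<bar>f c\<bar> * \<bar>g d - g c\<bar>"
        by (metis abs_mult abs_triangle_ineq)
      also have "\<dots> \<le> N * \<bar>f d - f c\<bar> + M * \<bar>g d - g c\<bar>"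
        using MN cd by (intro add_mono mult_right_mono) auto
      finally show "\<bar>f d * g d - f c * g c\<bar> \<le> N * \<bar>f d - f c\<bar> + M * \<bar>g d - g c\<bar>" .
    qed
    also have "\<dots> = N * (\<Sum>(c, d) \<in> P. \<bar>f d - f c\<bar>) + M * (\<Sum>(c, d) \<in> P. \<bar>g d - g c\<bar>)"
      by (simp add: split_beta sum.distrib sum_distrib_left)
    also have "\<dots> < N * (\<epsilon> / (2 * N)) + M * (\<epsilon> / (2 * M))"
      using d1(2)[OF P(1)] d2(2)[OF P(1)] P(2) MN by (intro add_strict_mono mult_strict_left_mono) auto
    also have "\<dots> = \<epsilon>" using MN by simp
    finally show "(\<Sum>(c, d) \<in> P. \<bar>f d * g d - f c * g c\<bar>) < \<epsilon>" .
  qed (use d1 d2 in auto)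
qed

lemma C1_imp_abs_cont:
  fixes U u :: "real \<Rightarrow> real"
  assumes U: "\<And>x. (U has_real_derivative u x) (at x)" and u: "continuous_on UNIV u"
  shows "abs_cont U"
  unfolding abs_cont_def abs_cont_wrt_iff
proof (intro allI impI)
  fix a b \<epsilon> :: real assume "\<epsilon> > 0"
  have "bounded (u ` {a..b})"
    using u by (auto intro: compact_imp_bounded compact_continuous_image continuous_on_subset)
  then obtain M where M: "M > 0" "\<And>x. x \<in> {a..b} \<Longrightarrow> \<bar>u x\<bar> \<le> M"
    unfolding bounded_pos by auto
  show "\<exists>\<delta>>0. \<forall>P. nonoverlapping a b P \<longrightarrow> (\<Sum>(c, d) \<in> P. d - c) < \<delta> \<longrightarrow> (\<Sum>(c, d) \<in> P. \<bar>U d - U c\<bar>) < \<epsilon>"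
  proof (intro exI[of _ "\<epsilon> / M"] conjI allI impI)
    fix P assume P: "nonoverlapping a b P" "(\<Sum>(c, d) \<in> P. d - c) < \<epsilon> / M"
    have "(\<Sum>(c, d) \<in> P. \<bar>U d - U c\<bar>) \<le> (\<Sum>(c, d) \<in> P. M * (d - c))"
    proof (rule sum_mono, clarify)
      fix c d assume "(c, d) \<in> P"
      then have cd: "a \<le> c" "c < d" "d \<le> b" using nonoverlappingD(2)[OF P(1)] by force+
      obtain z where "c < z" "z < d" "U d - U c = (d - c) * u z"
        using MVT2[OF \<open>c < d\<close>, of U u] U by blast
      then show "\<bar>U d - U c\<bar> \<le> M * (d - c)"
        using M(2)[of z] cd by (simp add: abs_mult mult.commute mult_right_mono)
    qed
    also have "\<dots> = M * (\<Sum>(c, d) \<in> P. d - c)" by (simp add: split_beta sum_distrib_left)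
    also have "\<dots> < \<epsilon>" using P(2) M by (simp add: field_simps)
    finally show "(\<Sum>(c, d) \<in> P. \<bar>U d - U c\<bar>) < \<epsilon>" .
  qed (use M \<open>\<epsilon> > 0\<close> in auto)
qed

section \<open>Square integrable functions on the line\<close>

text \<open>
  The indefinite integral from \<open>-\<infinity>\<close>. Working with its increments and its limits replaces the
  additivity of Lebesgue integrals over subintervals in most of what follows.
\<close>
lemma integrable_antiderivative:
  fixes f :: "real \<Rightarrow> real"
  assumes f: "integrable lebesgue f"
  obtains F where "\<And>a b. a \<le> b \<Longrightarrow> (f has_integral F b - F a) {a..b}"
    "(F \<longlongrightarrow> 0) at_bot" "(F \<longlongrightarrow> (LINT x|lebesgue. f x)) at_top"
proof
  define F where "F x = (LINT y|lebesgue. indicator {..x} y *\<^sub>R f y)" for x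
  have [measurable]: "f \<in> borel_measurable lebesgue" using f by auto
  have int: "integrable lebesgue (\<lambda>y. indicator S y *\<^sub>R f y)" if "S \<in> sets lebesgue" for S
    using f that by (intro integrable_mult_indicator)
  have meas: "(\<lambda>y. indicat_real {..x} y *\<^sub>R f y) \<in> borel_measurable lebesgue" for x
    by (rule borel_measurable_integrable[OF int]) simp
  show "(f has_integral F b - F a) {a..b}" if "a \<le> b" for a b
  proof -
    have "F b - F a = (LINT y|lebesgue. indicator {..b} y *\<^sub>R f y - indicator {..a} y *\<^sub>R f y)"
      unfolding F_def by (rule Bochner_Integration.integral_diff[symmetric]) (rule int, simp)+
    also have "\<dots> = (LINT y:{a<..b}|lebesgue. f y)"
      unfolding set_lebesgue_integral_def by (rule Bochner_Integration.integral_cong) (use that in \<open>auto simp: indicator_def\<close>)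
    finally have "(f has_integral F b - F a) {a<..b}"
      using has_integral_set_lebesgue[of "{a<..b}" f] int[of "{a<..b}"] by (simp add: set_integrable_def)
    then show ?thesis
      by (rule has_integral_spike_set_eq[THEN iffD1, rotated 2]) (auto intro: negligible_subset[of "{a}"])
  qed
  show "(F \<longlongrightarrow> (LINT x|lebesgue. f x)) at_top"
    unfolding F_def
  proof (rule integral_dominated_convergence_at_top)
    show "integrable lebesgue (\<lambda>x. \<bar>f x\<bar>)" using f by auto
    show "AE x in lebesgue. ((\<lambda>i. indicat_real {..i} x *\<^sub>R f x) \<longlongrightarrow> f x) at_top"
    proof (intro AE_I2 tendsto_eventually)
      fix x show "\<forall>\<^sub>F i in at_top. indicat_real {..i} x *\<^sub>R f x = f x"
        using eventually_ge_at_top[of x] by eventually_elim auto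
    qed
    show "\<forall>\<^sub>F i in at_top. AE x in lebesgue. norm (indicat_real {..i} x *\<^sub>R f x) \<le> \<bar>f x\<bar>"
      by (auto simp: indicator_def)
  qed (use meas in auto)
  have "((\<lambda>x. F (- x)) \<longlongrightarrow> (LINT x|(lebesgue :: real measure). (0::real))) at_top"
    unfolding F_def
  proof (rule integral_dominated_convergence_at_top)
    show "integrable lebesgue (\<lambda>x. \<bar>f x\<bar>)" using f by auto
    show "AE x in lebesgue. ((\<lambda>i. indicat_real {..-i} x *\<^sub>R f x) \<longlongrightarrow> 0) at_top"
    proof (intro AE_I2 tendsto_eventually)
      fix x show "\<forall>\<^sub>F i in at_top. indicat_real {..-i} x *\<^sub>R f x = 0"
        using eventually_gt_at_top[of "- x"] by eventually_elim (auto simp: indicator_def)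
    qed
    show "\<forall>\<^sub>F i in at_top. AE x in lebesgue. norm (indicat_real {..-i} x *\<^sub>R f x) \<le> \<bar>f x\<bar>"
      by (auto simp: indicator_def)
  qed (use meas in auto)
  then show "(F \<longlongrightarrow> 0) at_bot" by (simp add: filterlim_at_bot_mirror)
qed

text \<open>
  The cumulative square integral \<open>E\<close> is increasing and bounded. Being increasing, it sums over nonoverlapping families
  like any other increasing function.
\<close>
lemma L2_energy:
  assumes "g \<in> L2 lebesgue"
  obtains E where "mono E" "\<And>x. 0 \<le> E x" "\<And>x. E x \<le> (LINT x|lebesgue. (g x)\<^sup>2)"
    "\<And>a b. a \<le> b \<Longrightarrow> ((\<lambda>x. (g x)\<^sup>2) has_integral E b - E a) {a..b}"
proof -
  have "integrable lebesgue (\<lambda>x. (g x)\<^sup>2)" using assms by (simp add: L2_def)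
  then obtain E where E: "\<And>a b. a \<le> b \<Longrightarrow> ((\<lambda>x. (g x)\<^sup>2) has_integral E b - E a) {a..b}"
    "(E \<longlongrightarrow> 0) at_bot" "(E \<longlongrightarrow> (LINT x|lebesgue. (g x)\<^sup>2)) at_top"
    by (rule integrable_antiderivative) (rule that)
  have m: "E a \<le> E b" if "a \<le> b" for a b
    using has_integral_nonneg[OF E(1)[OF that]] by simp
  show thesis
  proof
    show "mono E" using m by (rule monoI)
    show "0 \<le> E x" for x
      by (rule tendsto_upperbound[OF E(2)]) (auto intro!: eventually_at_bot_linorderI[of x] m)
    show "E x \<le> (LINT x|lebesgue. (g x)\<^sup>2)" for x
      by (rule tendsto_lowerbound[OF E(3)]) (auto intro!: eventually_at_top_linorderI[of x] m)
  qed (rule E(1))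
qed

text \<open>
  If \<open>\<bar>w\<bar> \<ge> \<eta>\<close> held on a whole half line, the square integral would exceed every bound.
\<close>
lemma L2_small_values:
  assumes w: "w \<in> L2 lebesgue" and "\<eta> > 0"
  shows "\<exists>y\<ge>x. \<bar>w y\<bar> < \<eta>" "\<exists>y\<le>x. \<bar>w y\<bar> < \<eta>"
proof -
  obtain E where E: "\<And>x. 0 \<le> E x" "\<And>x. E x \<le> (LINT x|lebesgue. (w x)\<^sup>2)"
    "\<And>a b. a \<le> b \<Longrightarrow> ((\<lambda>x. (w x)\<^sup>2) has_integral E b - E a) {a..b}"
    using L2_energy[OF w] by metis
  define D where "D = (LINT x|lebesgue. (w x)\<^sup>2)"
  obtain n where n: "real n > D / \<eta>\<^sup>2" using reals_Archimedean2 by blast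
  have *: "\<exists>y\<in>{a..a + real n}. \<bar>w y\<bar> < \<eta>" for a
  proof (rule ccontr)
    assume "\<not> ?thesis"
    then have "\<eta>\<^sup>2 \<le> (w y)\<^sup>2" if "y \<in> {a..a + real n}" for y
      using that \<open>\<eta> > 0\<close> by (metis abs_le_square_iff abs_of_pos not_le)
    moreover have "((\<lambda>x. \<eta>\<^sup>2) has_integral \<eta>\<^sup>2 * real n) {a..a + real n}"
      using has_integral_const_real[of "\<eta>\<^sup>2" a "a + real n"] by (simp add: mult.commute)
    ultimately have "\<eta>\<^sup>2 * real n \<le> E (a + real n) - E a"
      by (intro has_integral_le[OF _ E(3)]) auto
    then have "\<eta>\<^sup>2 * real n \<le> D" using E(1)[of a] E(2)[of "a + real n"] by (simp add: D_def)
    then show False using n \<open>\<eta> > 0\<close> by (simp add: field_simps)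
  qed
  show "\<exists>y\<ge>x. \<bar>w y\<bar> < \<eta>" using *[of x] by auto
  show "\<exists>y\<le>x. \<bar>w y\<bar> < \<eta>" using *[of "x - real n"] by auto
qed

lemma AE_lebesgue_dense:
  assumes "AE x in lebesgue. P x" "(e::real) > 0"
  shows "\<exists>y. \<bar>y - x\<bar> < e \<and> P y"
proof (rule ccontr)
  assume "\<not> ?thesis"
  then have "ball x e \<subseteq> {y. \<not> P y}" by (auto simp: dist_real_def abs_minus_commute)
  then have "negligible (ball x e)"
    using assms(1) AE_lebesgue_iff_negligible negligible_subset by blast
  then show False using open_not_negligible[of "ball x e"] \<open>e > 0\<close> by simp
qed

lemma L2_cong_AE:
  assumes "f \<in> L2 lebesgue" "AE x in lebesgue. f x = g x"
  shows "g \<in> L2 lebesgue"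
proof -
  have f: "f \<in> borel_measurable lebesgue" "integrable lebesgue (\<lambda>x. (f x)\<^sup>2)" using assms(1) by (auto simp: L2_def)
  have g: "g \<in> borel_measurable lebesgue" using borel_measurable_AE[OF f(1) assms(2)] .
  have "integrable lebesgue (\<lambda>x. (g x)\<^sup>2)"
  proof (rule integrable_cong_AE_imp[OF f(2)])
    show "(\<lambda>x. (g x)\<^sup>2) \<in> borel_measurable lebesgue" using g by measurable
    show "AE x in lebesgue. (f x)\<^sup>2 = (g x)\<^sup>2" using assms(2) by eventually_elim simp
  qed
  then show ?thesis using g by (simp add: L2_def)
qed

lemma L2_diff:
  assumes "f \<in> L2 lebesgue" "g \<in> L2 lebesgue"
  shows "(\<lambda>x. f x - g x) \<in> L2 lebesgue"
proof -
  have [measurable]: "f \<in> borel_measurable lebesgue" "g \<in> borel_measurable lebesgue"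
    and i: "integrable lebesgue (\<lambda>x. (f x)\<^sup>2)" "integrable lebesgue (\<lambda>x. (g x)\<^sup>2)"
    using assms by (auto simp: L2_def)
  have "integrable lebesgue (\<lambda>x. (f x - g x)\<^sup>2)"
  proof (rule Bochner_Integration.integrable_bound)
    show "integrable lebesgue (\<lambda>x. 2 * (f x)\<^sup>2 + 2 * (g x)\<^sup>2)" using i by auto
    have "(f x - g x)\<^sup>2 \<le> 2 * (f x)\<^sup>2 + 2 * (g x)\<^sup>2" for x
      using zero_le_power2[of "f x + g x"] by (simp add: power2_eq_square algebra_simps)
    then show "AE x in lebesgue. norm ((f x - g x)\<^sup>2) \<le> norm (2 * (f x)\<^sup>2 + 2 * (g x)\<^sup>2)" by simp
  qed measurable
  then show ?thesis by (simp add: L2_def)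
qed

lemma L2_mult_integrable:
  assumes "f \<in> L2 lebesgue" "g \<in> L2 lebesgue"
  shows "integrable lebesgue (\<lambda>x. f x * g x)"
proof (rule Bochner_Integration.integrable_bound)
  have [measurable]: "f \<in> borel_measurable lebesgue" "g \<in> borel_measurable lebesgue"
    and i: "integrable lebesgue (\<lambda>x. (f x)\<^sup>2)" "integrable lebesgue (\<lambda>x. (g x)\<^sup>2)"
    using assms by (auto simp: L2_def)
  show "integrable lebesgue (\<lambda>x. (f x)\<^sup>2 + (g x)\<^sup>2)" using i by auto
  have "\<bar>f x * g x\<bar> \<le> (f x)\<^sup>2 + (g x)\<^sup>2" for x
  proof -
    have "2 * (\<bar>f x\<bar> * \<bar>g x\<bar>) \<le> (f x)\<^sup>2 + (g x)\<^sup>2"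
      using zero_le_power2[of "\<bar>f x\<bar> - \<bar>g x\<bar>"] by (simp add: power2_eq_square algebra_simps)
    moreover have "0 \<le> \<bar>f x\<bar> * \<bar>g x\<bar>" by simp
    ultimately show ?thesis unfolding abs_mult by linarith
  qed
  then show "AE x in lebesgue. norm (f x * g x) \<le> norm ((f x)\<^sup>2 + (g x)\<^sup>2)" by simp
  show "(\<lambda>x. f x * g x) \<in> borel_measurable lebesgue" by measurable
qed

section \<open>The Stieltjes measure and the regular subspace\<close>

lemma is_ds_density_measurable:
  assumes "is_ds_density s u h"
  shows "h \<in> borel_measurable borel"
  using assms unfolding is_ds_density_def by (metis measurable_cong_sets sets_interval_measure)

locale scaling_function =
  fixes s :: "real \<Rightarrow> real" and G :: "real set"
  assumes strict_mono: "strict_mono s"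
    and abs_cont: "abs_cont s"
    and deriv_01: "AE x in lebesgue. (s has_real_derivative 0) (at x) \<or> (s has_real_derivative 1) (at x)"
    and open_G: "open G"
    and G_iff: "AE x in lebesgue. x \<in> G \<longleftrightarrow> (s has_real_derivative 1) (at x)"
begin

lemma mono: "mono s"
  using strict_mono by (rule strict_mono_mono)

lemma isCont: "isCont s x"
  using abs_cont_wrt_isCont[of "\<lambda>x. x" s x] abs_cont by (simp add: abs_cont_def)

lemma G_measurable [measurable]: "G \<in> sets borel"
  using open_G by simp

lemma AE_deriv_s: "AE x in lebesgue. deriv s x = indicator G x"
  using deriv_01 G_iff by eventually_elim (auto simp: indicator_def DERIV_imp_deriv)

lemma has_integral_indicator_G:
  assumes "a \<le> b"
  shows "(indicator G has_integral s b - s a) {a..b}"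
proof -
  have "negligible {x. \<not> deriv s x = indicator G x}" using AE_deriv_s by (simp only: AE_lebesgue_iff_negligible)
  then show ?thesis by (rule has_integral_spike[OF _ _ abs_cont_FTC[OF abs_cont assms]]) auto
qed

text \<open>
  The density of \<open>ds\<close> with respect to Lebesgue measure is \<open>s'\<close>, hence \<open>1\<close> on \<open>G\<close> and \<open>0\<close> elsewhere.
\<close>
lemma interval_measure_eq: "interval_measure s = density lborel (\<lambda>x. ennreal (indicator G x))"
proof -
  obtain h where h: "is_ds_density (\<lambda>x. x) s h" "density (interval_measure (\<lambda>x. x)) (\<lambda>x. ennreal (h x)) = interval_measure s"
    by (rule mono_density_exists[of "\<lambda>x. x" s]) (use mono abs_cont in \<open>auto simp: abs_cont_def mono_def\<close>)
  have "AE x in lebesgue. h x = indicator G x"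
    using AE_deriv_s is_ds_density_id_AE_derivative[OF h(1)] by eventually_elim (simp add: DERIV_imp_deriv)
  then have ae: "AE x in lborel. h x = indicator G x" by (simp add: AE_completion_iff)
  have [measurable]: "h \<in> borel_measurable borel" using h(1) by (rule is_ds_density_measurable)
  show ?thesis
    unfolding h(2)[symmetric] lborel_eq_real[symmetric]
    by (rule density_cong) (use ae in \<open>auto elim: eventually_mono\<close>)
qed

text \<open>
  Integrating \<open>h\<close> against \<open>ds\<close> is integrating \<open>1\<^sub>G h\<close> against Lebesgue measure, so the differentiation
  theorem applies. In particular the density is unique up to \<open>ds\<close>-null sets, and any choice of it may be
  replaced by the ordinary derivative.
\<close>
lemma is_ds_density_AE_derivative:
  assumes "is_ds_density s v h"
  shows "AE x in lebesgue. (v has_real_derivative indicator G x * h x) (at x)"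
proof (rule AE_has_real_derivative_of_has_integral)
  fix a b :: real assume "a \<le> b"
  have [measurable]: "h \<in> borel_measurable borel" using assms by (rule is_ds_density_measurable)
  have "set_integrable (interval_measure s) {a<..b} h"
    and v: "v b - v a = (LINT x:{a<..b}|interval_measure s. h x)"
    using assms \<open>a \<le> b\<close> unfolding is_ds_density_def by blast+
  then have "set_integrable lborel {a<..b} (\<lambda>x. indicator G x * h x)"
    unfolding set_integrable_def interval_measure_eq by (subst (asm) integrable_density) (auto simp: ac_simps)
  moreover have "(LINT x:{a<..b}|interval_measure s. h x) = (LINT x:{a<..b}|lborel. indicator G x * h x)"
    unfolding set_lebesgue_integral_def interval_measure_eq by (subst integral_density) (auto simp: ac_simps)
  ultimately show "((\<lambda>x. indicator G x * h x) has_integral v b - v a) {a..b}"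
    using v set_integrable_Ioc_has_integral by metis
qed

lemma ds_deriv:
  assumes "abs_cont_wrt s v"
  shows "ds_deriv s v \<in> borel_measurable borel"
    "AE x in lebesgue. (v has_real_derivative indicator G x * ds_deriv s v x) (at x)"
proof -
  have "is_ds_density s v (ds_deriv s v)"
    unfolding ds_deriv_def by (rule someI_ex[OF abs_cont_wrt_density_exists[OF mono isCont assms]])
  then show "ds_deriv s v \<in> borel_measurable borel"
    "AE x in lebesgue. (v has_real_derivative indicator G x * ds_deriv s v x) (at x)"
    using is_ds_density_AE_derivative is_ds_density_measurable by auto
qed

lemma AE_deriv_eq:
  assumes "abs_cont_wrt s v"
  shows "AE x in lebesgue. indicator G x * ds_deriv s v x = deriv v x"
  using ds_deriv(2)[OF assms] by eventually_elim (simp add: DERIV_imp_deriv)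

lemma AE_has_deriv:
  assumes "abs_cont_wrt s v"
  shows "AE x in lebesgue. (v has_real_derivative deriv v x) (at x)"
  using ds_deriv(2)[OF assms] by eventually_elim (simp add: DERIV_imp_deriv)

lemma AE_deriv_eq_0:
  assumes "abs_cont_wrt s v"
  shows "AE x in lebesgue. x \<notin> G \<longrightarrow> deriv v x = 0"
  using AE_deriv_eq[OF assms] by eventually_elim auto

lemma measurable_deriv:
  assumes "abs_cont_wrt s v"
  shows "deriv v \<in> borel_measurable lebesgue"
proof (rule borel_measurable_AE[OF _ AE_deriv_eq[OF assms]])
  have [measurable]: "ds_deriv s v \<in> borel_measurable borel" using ds_deriv(1)[OF assms] .
  show "(\<lambda>x. indicator G x * ds_deriv s v x) \<in> borel_measurable lebesgue"
    by (rule measurable_completion) measurable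
qed

lemma
  assumes v: "abs_cont_wrt s v"
  shows integrable_ds_deriv_sq: "integrable (interval_measure s) (\<lambda>x. (ds_deriv s v x)\<^sup>2) \<longleftrightarrow>
      integrable lebesgue (\<lambda>x. (deriv v x)\<^sup>2)"
    and Es_eq: "Es s v v = 1/2 * (LINT x|lebesgue. (deriv v x)\<^sup>2)"
proof -
  let ?k = "ds_deriv s v"
  have [measurable]: "?k \<in> borel_measurable borel" "deriv v \<in> borel_measurable lebesgue"
    using ds_deriv(1)[OF v] measurable_deriv[OF v] .
  have [measurable]: "(\<lambda>x. indicator G x * (?k x)\<^sup>2) \<in> borel_measurable lebesgue"
    by (rule measurable_completion) measurable
  have ae: "AE x in lebesgue. indicator G x * (?k x)\<^sup>2 = (deriv v x)\<^sup>2"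
    using AE_deriv_eq[OF v] by eventually_elim (auto simp: indicator_def split: if_splits)
  have "integrable (interval_measure s) (\<lambda>x. (?k x)\<^sup>2) \<longleftrightarrow> integrable lborel (\<lambda>x. indicator G x * (?k x)\<^sup>2)"
    unfolding interval_measure_eq by (subst integrable_density) auto
  also have "\<dots> \<longleftrightarrow> integrable lebesgue (\<lambda>x. indicator G x * (?k x)\<^sup>2)"
    by (subst integrable_completion) auto
  also have "\<dots> \<longleftrightarrow> integrable lebesgue (\<lambda>x. (deriv v x)\<^sup>2)"
    by (rule integrable_cong_AE) (use ae in auto)
  finally show "integrable (interval_measure s) (\<lambda>x. (?k x)\<^sup>2) \<longleftrightarrow> integrable lebesgue (\<lambda>x. (deriv v x)\<^sup>2)" .
  have "Es s v v = 1/2 * (LINT x|lborel. indicator G x * (?k x)\<^sup>2)"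
    unfolding Es_def interval_measure_eq by (subst integral_density) (auto simp: power2_eq_square)
  also have "(LINT x|lborel. indicator G x * (?k x)\<^sup>2) = (LINT x|lebesgue. indicator G x * (?k x)\<^sup>2)"
    by (subst integral_completion) auto
  also have "\<dots> = (LINT x|lebesgue. (deriv v x)\<^sup>2)"
    by (rule integral_cong_AE) (use ae in auto)
  finally show "Es s v v = 1/2 * (LINT x|lebesgue. (deriv v x)\<^sup>2)" .
qed

text \<open>
  The regular subspace in terms of the ordinary derivative. Together with \<open>Es_eq\<close> this is the statement that
  the form on the regular subspace is the restriction of the Brownian one.
\<close>
lemma Fs_iff: "v \<in> Fs s \<longleftrightarrow> v \<in> L2 lebesgue \<and> abs_cont_wrt s v \<and> deriv v \<in> L2 lebesgue"
  using integrable_ds_deriv_sq[of v] ds_deriv(1)[of v] measurable_deriv[of v]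
  by (auto simp: Fs_def L2_def)

lemma deriv_diff_L2:
  assumes "abs_cont_wrt s v" "abs_cont_wrt s w" "deriv v \<in> L2 lebesgue" "deriv w \<in> L2 lebesgue"
  shows "deriv (\<lambda>x. v x - w x) \<in> L2 lebesgue"
proof (rule L2_cong_AE[OF L2_diff[OF assms(3,4)]])
  show "AE x in lebesgue. deriv v x - deriv w x = deriv (\<lambda>x. v x - w x) x"
    using AE_has_deriv[OF assms(1)] AE_has_deriv[OF assms(2)]
    by eventually_elim (metis DERIV_diff DERIV_imp_deriv)
qed

lemma Fs_diff: "v \<in> Fs s \<Longrightarrow> w \<in> Fs s \<Longrightarrow> (\<lambda>x. v x - w x) \<in> Fs s"
  unfolding Fs_iff by (simp add: L2_diff abs_cont_wrt_diff deriv_diff_L2)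

text \<open>
  The inequality \<open>\<bar>a\<bar> \<le> t a\<^sup>2/2 + 1/(2 t)\<close>, integrated over \<open>G\<close>, replaces the Cauchy-Schwarz inequality
  \<open>\<bar>v d - v c\<bar>\<^sup>2 \<le> (E d - E c) (s d - s c)\<close>. In this linear form it can be summed over families of intervals.
\<close>
lemma increment_bound:
  assumes v: "abs_cont_wrt s v" "deriv v \<in> L2 lebesgue"
  obtains E where "mono E" "\<And>x. 0 \<le> E x" "\<And>x. E x \<le> (LINT x|lebesgue. (deriv v x)\<^sup>2)"
    "\<And>t c d. t > 0 \<Longrightarrow> c \<le> d \<Longrightarrow> \<bar>v d - v c\<bar> \<le> t / 2 * (E d - E c) + (s d - s c) / (2 * t)"
proof -
  obtain E where E: "mono E" "\<And>x. 0 \<le> E x" "\<And>x. E x \<le> (LINT x|lebesgue. (deriv v x)\<^sup>2)"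
    "\<And>a b. a \<le> b \<Longrightarrow> ((\<lambda>x. (deriv v x)\<^sup>2) has_integral E b - E a) {a..b}"
    by (rule L2_energy[OF v(2)]) (rule that)
  have bound: "\<bar>v d - v c\<bar> \<le> t / 2 * (E d - E c) + (s d - s c) / (2 * t)" if "t > 0" "c \<le> d" for t c d
  proof -
    \<comment> \<open>An almost everywhere equal version of \<open>v'\<close> for which the estimate holds at every point.\<close>
    define g where "g x = indicator G x * deriv v x" for x
    have "negligible {x. \<not> (x \<notin> G \<longrightarrow> deriv v x = 0)}"
      using AE_deriv_eq_0[OF v(1)] by (simp only: AE_lebesgue_iff_negligible)
    then have g: "(g has_integral v d - v c) {c..d}"
      by (rule has_integral_spike[OF _ _ abs_cont_FTC[OF abs_cont_trans[OF abs_cont v(1)] that(2)]])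
        (auto simp: g_def indicator_def)
    have r: "((\<lambda>x. t / 2 * (deriv v x)\<^sup>2 + 1 / (2 * t) * indicator G x) has_integral
        (t / 2 * (E d - E c) + 1 / (2 * t) * (s d - s c))) {c..d}"
      by (intro has_integral_add has_integral_mult_right E(4) has_integral_indicator_G that)
    have "\<bar>g x\<bar> \<le> t / 2 * (deriv v x)\<^sup>2 + 1 / (2 * t) * indicator G x" for x
    proof (cases "x \<in> G")
      case True
      have "0 \<le> (t * \<bar>deriv v x\<bar> - 1)\<^sup>2" by simp
      also have "\<dots> = t\<^sup>2 * (deriv v x)\<^sup>2 + 1 - 2 * t * \<bar>deriv v x\<bar>"
        by (simp add: power2_eq_square algebra_simps)
      finally have "2 * t * \<bar>deriv v x\<bar> \<le> t\<^sup>2 * (deriv v x)\<^sup>2 + 1" by simp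
      then have "\<bar>deriv v x\<bar> \<le> (t\<^sup>2 * (deriv v x)\<^sup>2 + 1) / (2 * t)" using \<open>t > 0\<close> by (simp add: field_simps)
      also have "\<dots> = t / 2 * (deriv v x)\<^sup>2 + 1 / (2 * t)" using \<open>t > 0\<close> by (simp add: field_simps power2_eq_square)
      finally show ?thesis using True by (simp add: g_def)
    qed (use \<open>t > 0\<close> in \<open>simp add: g_def\<close>)
    then have "norm (integral {c..d} g) \<le> integral {c..d} (\<lambda>x. t / 2 * (deriv v x)\<^sup>2 + 1 / (2 * t) * indicator G x)"
      using g r by (intro integral_norm_bound_integral) auto
    then show ?thesis using integral_unique[OF g] integral_unique[OF r] by simp
  qed
  show thesis using that[OF E(1-3) bound] .
qed

end

lemma abs_cont_AE_derivative:
  assumes "abs_cont u"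
  shows "AE x in lebesgue. (u has_real_derivative deriv u x) (at x)"
  using AE_has_real_derivative_of_has_integral[OF abs_cont_FTC[OF assms]] .

lemma abs_cont_continuous: "abs_cont u \<Longrightarrow> continuous_on UNIV u"
  using abs_cont_wrt_isCont[of "\<lambda>x. x" u] by (auto simp: abs_cont_def intro!: continuous_at_imp_continuous_on)

text \<open>
  Integration by parts for a continuously differentiable and an absolutely continuous factor: their product is
  absolutely continuous.
\<close>
lemma product_rule_has_integral:
  assumes W: "\<And>x. (W has_real_derivative w x) (at x)" "continuous_on UNIV w"
    and v: "abs_cont v" and "a \<le> b"
  shows "((\<lambda>x. w x * v x + W x * deriv v x) has_integral W b * v b - W a * v a) {a..b}"
proof -
  have "AE x in lebesgue. deriv (\<lambda>x. W x * v x) x = w x * v x + W x * deriv v x"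
    using abs_cont_AE_derivative[OF v]
  proof eventually_elim
    case (elim x)
    have "((\<lambda>x. W x * v x) has_real_derivative w x * v x + deriv v x * W x) (at x)"
      using DERIV_mult[OF W(1) elim] .
    then show ?case by (simp add: DERIV_imp_deriv mult.commute)
  qed
  then have "negligible {x. \<not> deriv (\<lambda>x. W x * v x) x = w x * v x + W x * deriv v x}"
    by (simp only: AE_lebesgue_iff_negligible)
  then show ?thesis
    by (rule has_integral_spike[OF _ _ abs_cont_FTC[OF abs_cont_mult[OF C1_imp_abs_cont[OF W] v] \<open>a \<le> b\<close>]]) auto
qed

lemma antiderivative_exists:
  fixes u :: "real \<Rightarrow> real"
  assumes "continuous_on UNIV u"
  obtains U where "\<And>x. (U has_real_derivative u x) (at x)"
proof -
  have "\<exists>F. \<forall>x::real. - \<infinity> < ereal x \<longrightarrow> ereal x < \<infinity> \<longrightarrow> (F has_vector_derivative u x) (at x)"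
    by (rule einterval_antiderivative) (use assms in \<open>auto simp: continuous_on_eq_continuous_at\<close>)
  then show thesis using that by (auto simp: has_real_derivative_iff_has_vector_derivative)
qed

lemma equal_increments:
  fixes f g :: "real \<Rightarrow> real"
  assumes "\<And>a b. a \<le> b \<Longrightarrow> f b - f a = g b - g a"
  shows "f = (\<lambda>x. g x + (f 0 - g 0))"
proof
  fix x show "f x = g x + (f 0 - g 0)"
    using assms[of 0 x] assms[of x 0] by (cases "0 \<le> x") auto
qed

section \<open>The extended Dirichlet space\<close>

text \<open>
  Choose \<open>t\<close> small first and let \<open>B\<close> tend to zero afterwards.
\<close>
lemma tendsto_zero_tradeoff:
  fixes v B :: "'a \<Rightarrow> real"
  assumes bound: "\<And>t x. t > 0 \<Longrightarrow> \<bar>v x\<bar> \<le> t * K + B x / t" and B: "(B \<longlongrightarrow> 0) F"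
  shows "(v \<longlongrightarrow> 0) F"
proof (rule tendstoI)
  fix \<epsilon> :: real assume "\<epsilon> > 0"
  define k where "k = \<bar>K\<bar> + 1"
  define t where "t = \<epsilon> / (2 * k)"
  have "k > 0" by (simp add: k_def)
  then have "t > 0" using \<open>\<epsilon> > 0\<close> by (simp add: t_def)
  have "t * K \<le> t * k" using \<open>t > 0\<close> by (intro mult_left_mono) (auto simp: k_def)
  also have "\<dots> = \<epsilon> / 2" using \<open>k > 0\<close> by (simp add: t_def)
  finally have tK: "t * K \<le> \<epsilon> / 2" .
  have "\<forall>\<^sub>F x in F. dist (B x) 0 < t * \<epsilon> / 2" using tendstoD[OF B, of "t * \<epsilon> / 2"] \<open>t > 0\<close> \<open>\<epsilon> > 0\<close> by simp
  then show "\<forall>\<^sub>F x in F. dist (v x) 0 < \<epsilon>"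
  proof eventually_elim
    case (elim x)
    then have "B x / t < \<epsilon> / 2" using \<open>t > 0\<close> by (simp add: field_simps)
    then have "\<bar>v x\<bar> < \<epsilon>" using bound[OF \<open>t > 0\<close>, of x] tK by linarith
    then show ?case by simp
  qed
qed

context scaling_function
begin

text \<open>
  Compare \<open>v x\<close> with values of \<open>v\<close> near infinity, which are arbitrarily small since \<open>v \<in> L\<^sup>2\<close>; only the variation
  of \<open>s\<close> beyond \<open>x\<close> enters.
\<close>
lemma Fs_decay:
  assumes v: "v \<in> Fs s" and "t > 0"
  defines "D \<equiv> LINT x|lebesgue. (deriv v x)\<^sup>2"
  shows "(\<And>y. s y \<le> S) \<Longrightarrow> \<bar>v x\<bar> \<le> t / 2 * D + (S - s x) / (2 * t)"
    and "(\<And>y. S \<le> s y) \<Longrightarrow> \<bar>v x\<bar> \<le> t / 2 * D + (s x - S) / (2 * t)"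
proof -
  have v': "v \<in> L2 lebesgue" "abs_cont_wrt s v" "deriv v \<in> L2 lebesgue" using v by (simp_all add: Fs_iff)
  obtain E where E: "mono E" "\<And>x. 0 \<le> E x" "\<And>x. E x \<le> (LINT x|lebesgue. (deriv v x)\<^sup>2)"
    "\<And>t c d. t > 0 \<Longrightarrow> c \<le> d \<Longrightarrow> \<bar>v d - v c\<bar> \<le> t / 2 * (E d - E c) + (s d - s c) / (2 * t)"
    by (rule increment_bound[OF v'(2,3)]) (rule that)
  have le: "\<bar>v d - v c\<bar> \<le> t / 2 * D + (s d - s c) / (2 * t)" if "c \<le> d" for c d
  proof -
    have "E d - E c \<le> D" using E(2)[of c] E(3)[of d] by (simp add: D_def)
    then have "t / 2 * (E d - E c) \<le> t / 2 * D" using \<open>t > 0\<close> by (intro mult_left_mono) auto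
    then show ?thesis using E(4)[OF \<open>t > 0\<close> that] by linarith
  qed
  show "\<bar>v x\<bar> \<le> t / 2 * D + (S - s x) / (2 * t)" if "\<And>y. s y \<le> S"
  proof (rule field_le_epsilon)
    fix \<eta> :: real assume "\<eta> > 0"
    then obtain y where y: "y \<ge> x" "\<bar>v y\<bar> < \<eta>" using L2_small_values(1)[OF v'(1)] by blast
    have "(s y - s x) / (2 * t) \<le> (S - s x) / (2 * t)" using that \<open>t > 0\<close> by (simp add: divide_right_mono)
    then show "\<bar>v x\<bar> \<le> t / 2 * D + (S - s x) / (2 * t) + \<eta>" using le[OF y(1)] y(2) by linarith
  qed
  show "\<bar>v x\<bar> \<le> t / 2 * D + (s x - S) / (2 * t)" if "\<And>y. S \<le> s y"
  proof (rule field_le_epsilon)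
    fix \<eta> :: real assume "\<eta> > 0"
    then obtain y where y: "y \<le> x" "\<bar>v y\<bar> < \<eta>" using L2_small_values(2)[OF v'(1)] by blast
    have "(s x - s y) / (2 * t) \<le> (s x - S) / (2 * t)" using that \<open>t > 0\<close> by (simp add: divide_right_mono)
    then show "\<bar>v x\<bar> \<le> t / 2 * D + (s x - S) / (2 * t) + \<eta>" using le[OF y(1)] y(2) by linarith
  qed
qed

lemma Fs_increment_bound:
  assumes v: "v \<in> Fs s" "(LINT x|lebesgue. (deriv v x)\<^sup>2) \<le> 2" and "t > 0" "c \<le> d"
  shows "\<bar>v d - v c\<bar> \<le> t + (s d - s c) / (2 * t)"
proof -
  obtain E where E: "\<And>x. 0 \<le> E x" "\<And>x. E x \<le> (LINT x|lebesgue. (deriv v x)\<^sup>2)"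
    "\<And>t c d. t > 0 \<Longrightarrow> c \<le> d \<Longrightarrow> \<bar>v d - v c\<bar> \<le> t / 2 * (E d - E c) + (s d - s c) / (2 * t)"
    using increment_bound[of v] v(1) by (metis Fs_iff)
  have "E d - E c \<le> 2" using E(1)[of c] E(2)[of d] v(2) by linarith
  then have "t / 2 * (E d - E c) \<le> t / 2 * 2" using \<open>t > 0\<close> by (intro mult_left_mono) auto
  then show ?thesis using E(3)[OF \<open>t > 0\<close> \<open>c \<le> d\<close>] by simp
qed

lemma Fs_sum_increment_bound:
  assumes v: "v \<in> Fs s" "(LINT x|lebesgue. (deriv v x)\<^sup>2) \<le> 2" and "t > 0" and P: "nonoverlapping a b P" "a \<le> b"
  shows "(\<Sum>(c, d)\<in>P. \<bar>v d - v c\<bar>) \<le> t + (\<Sum>(c, d)\<in>P. s d - s c) / (2 * t)"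
proof -
  obtain E where E: "mono E" "\<And>x. 0 \<le> E x" "\<And>x. E x \<le> (LINT x|lebesgue. (deriv v x)\<^sup>2)"
    "\<And>t c d. t > 0 \<Longrightarrow> c \<le> d \<Longrightarrow> \<bar>v d - v c\<bar> \<le> t / 2 * (E d - E c) + (s d - s c) / (2 * t)"
    using increment_bound[of v] v(1) by (metis Fs_iff)
  have "(\<Sum>(c, d)\<in>P. \<bar>v d - v c\<bar>) \<le> (\<Sum>(c, d)\<in>P. t / 2 * (E d - E c) + (s d - s c) / (2 * t))"
    by (rule sum_mono) (use E(4)[OF \<open>t > 0\<close>] nonoverlappingD(2)[OF P(1)] in \<open>force simp: less_imp_le\<close>)
  also have "\<dots> = t / 2 * (\<Sum>(c, d)\<in>P. E d - E c) + (\<Sum>(c, d)\<in>P. s d - s c) / (2 * t)"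
    by (simp add: split_beta sum.distrib sum_distrib_left sum_divide_distrib)
  finally have 1: "(\<Sum>(c, d)\<in>P. \<bar>v d - v c\<bar>) \<le> t / 2 * (\<Sum>(c, d)\<in>P. E d - E c) + (\<Sum>(c, d)\<in>P. s d - s c) / (2 * t)" .
  have "(\<Sum>(c, d)\<in>P. E d - E c) \<le> E b - E a" by (rule sum_increments_le[OF E(1) P])
  then have "(\<Sum>(c, d)\<in>P. E d - E c) \<le> 2" using E(2)[of a] E(3)[of b] v(2) by linarith
  then have "t / 2 * (\<Sum>(c, d)\<in>P. E d - E c) \<le> t / 2 * 2" using \<open>t > 0\<close> by (intro mult_left_mono) auto
  then show ?thesis using 1 by simp
qed

text \<open>
  After dropping finitely many terms of an approximating sequence, the energies of the differences from the first
  remaining term are bounded. This makes the sequence equicontinuous, so it converges everywhere and not only almost everywhere.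
\<close>
lemma Fse_approximation:
  assumes v: "v \<in> Fse s"
  obtains f where "\<And>n. f n \<in> Fs s" "\<And>n. (LINT x|lebesgue. (deriv (\<lambda>x. f n x - f 0 x) x)\<^sup>2) \<le> 2"
    "\<And>x. (\<lambda>n. f n x) \<longlonglongrightarrow> v x"
proof -
  obtain g where g: "\<And>n. g n \<in> Fs s"
    "\<And>\<epsilon>. \<epsilon> > 0 \<Longrightarrow> \<exists>N. \<forall>m\<ge>N. \<forall>n\<ge>N. Es s (\<lambda>x. g m x - g n x) (\<lambda>x. g m x - g n x) < \<epsilon>"
    "AE x in lebesgue. (\<lambda>n. g n x) \<longlonglongrightarrow> v x" and cont: "continuous_on UNIV v"
    using v by (auto simp: Fse_def extended_dirichlet_space_def)
  obtain N where N: "\<And>m n. m \<ge> N \<Longrightarrow> n \<ge> N \<Longrightarrow> Es s (\<lambda>x. g m x - g n x) (\<lambda>x. g m x - g n x) < 1"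
    using g(2)[of 1] by auto
  define f where "f n = g (n + N)" for n
  have f: "f n \<in> Fs s" for n using g by (simp add: f_def)
  have E: "(LINT x|lebesgue. (deriv (\<lambda>x. f n x - f 0 x) x)\<^sup>2) \<le> 2" for n
    using N[of "n + N" N] Es_eq[of "\<lambda>x. f n x - f 0 x"] Fs_diff[OF f f, of n 0]
    by (simp add: f_def Fs_iff)
  have "(\<lambda>n. f n x) \<longlonglongrightarrow> v x" for x
  proof (rule LIMSEQ_I)
    fix \<epsilon> :: real assume "\<epsilon> > 0"
    \<comment> \<open>Between \<open>x\<close> and a nearby point of convergence, \<open>f n - f 0\<close> changes by less than \<open>2 t\<close> and \<open>f 0\<close> by less than \<open>t\<close>.\<close>
    define t where "t = \<epsilon> / 10"
    have "t > 0" using \<open>\<epsilon> > 0\<close> by (simp add: t_def)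
    have "isCont v x" using cont by (simp add: continuous_on_eq_continuous_at)
    then obtain d1 where d1: "d1 > 0" "\<And>y. \<bar>y - x\<bar> < d1 \<Longrightarrow> \<bar>v y - v x\<bar> < t"
      using \<open>t > 0\<close> unfolding continuous_at_eps_delta dist_real_def by blast
    have "isCont (f 0) x" using f[of 0] abs_cont_wrt_isCont[OF _ isCont] by (auto simp: Fs_iff)
    then obtain d2 where d2: "d2 > 0" "\<And>y. \<bar>y - x\<bar> < d2 \<Longrightarrow> \<bar>f 0 y - f 0 x\<bar> < t"
      using \<open>t > 0\<close> unfolding continuous_at_eps_delta dist_real_def by blast
    obtain d3 where d3: "d3 > 0" "\<And>y. \<bar>y - x\<bar> < d3 \<Longrightarrow> \<bar>s y - s x\<bar> < 2 * t * t"
      using isCont[of x] \<open>t > 0\<close> unfolding continuous_at_eps_delta dist_real_def by (metis mult_pos_pos zero_less_numeral)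
    obtain y where y: "\<bar>y - x\<bar> < min d1 (min d2 d3)" "(\<lambda>n. g n y) \<longlonglongrightarrow> v y"
      using AE_lebesgue_dense[OF g(3), of "min d1 (min d2 d3)" x] d1(1) d2(1) d3(1) by auto
    have fy: "(\<lambda>n. f n y) \<longlonglongrightarrow> v y"
      unfolding f_def by (rule LIMSEQ_ignore_initial_segment[OF y(2)])
    obtain M where M: "\<And>n. n \<ge> M \<Longrightarrow> \<bar>f n y - v y\<bar> < t"
      using LIMSEQ_D[OF fy \<open>t > 0\<close>] by auto
    have close: "\<bar>f n y - f n x\<bar> < 3 * t" for n
    proof -
      have "\<bar>(f n y - f 0 y) - (f n x - f 0 x)\<bar> \<le> t + \<bar>s y - s x\<bar> / (2 * t)"
      proof (cases "x \<le> y")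
        case True
        then show ?thesis
          using Fs_increment_bound[OF Fs_diff[OF f f] E \<open>t > 0\<close> True] monoD[OF mono True] by simp
      next
        case False
        then have "y \<le> x" by simp
        then show ?thesis
          using Fs_increment_bound[OF Fs_diff[OF f f] E \<open>t > 0\<close> \<open>y \<le> x\<close>, of n] monoD[OF mono \<open>y \<le> x\<close>]
          by (simp add: abs_minus_commute)
      qed
      moreover have "\<bar>s y - s x\<bar> / (2 * t) < t" using d3(2)[of y] y(1) \<open>t > 0\<close> by (simp add: field_simps)
      moreover have "\<bar>f 0 y - f 0 x\<bar> < t" using d2(2) y(1) by simp
      ultimately show ?thesis by linarith
    qed
    show "\<exists>no. \<forall>n\<ge>no. norm (f n x - v x) < \<epsilon>"
    proof (intro exI allI impI)
      fix n assume "n \<ge> M"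
      then show "norm (f n x - v x) < \<epsilon>"
        using M[of n] close[of n] d1(2)[of y] y(1) \<open>\<epsilon> > 0\<close> unfolding t_def real_norm_def by linarith
    qed
  qed
  then show thesis using that[of f] f E by blast
qed

text \<open>
  The bound on sums of increments is uniform along the approximating sequence and hence survives the limit.
\<close>
lemma Fse_abs_cont:
  assumes "v \<in> Fse s"
  shows "abs_cont_wrt s v"
proof -
  obtain f where f: "\<And>n. f n \<in> Fs s" "\<And>n. (LINT x|lebesgue. (deriv (\<lambda>x. f n x - f 0 x) x)\<^sup>2) \<le> 2"
    "\<And>x. (\<lambda>n. f n x) \<longlonglongrightarrow> v x" by (rule Fse_approximation[OF assms]) (rule that)
  have f0: "abs_cont_wrt s (f 0)" using f(1) by (simp add: Fs_iff)
  show ?thesis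
    unfolding abs_cont_wrt_iff
  proof (intro allI impI)
    fix a b \<epsilon> :: real assume "\<epsilon> > 0"
    define t where "t = \<epsilon> / 4"
    have "t > 0" using \<open>\<epsilon> > 0\<close> by (simp add: t_def)
    obtain \<delta> where \<delta>: "\<delta> > 0" "\<And>P. nonoverlapping a b P \<Longrightarrow> (\<Sum>(c, d) \<in> P. s d - s c) < \<delta> \<Longrightarrow> (\<Sum>(c, d) \<in> P. \<bar>f 0 d - f 0 c\<bar>) < t"
      using abs_cont_wrtE[OF f0 \<open>t > 0\<close>, of a b] by blast
    show "\<exists>\<delta>>0. \<forall>P. nonoverlapping a b P \<longrightarrow> (\<Sum>(c, d) \<in> P. s d - s c) < \<delta> \<longrightarrow> (\<Sum>(c, d) \<in> P. \<bar>v d - v c\<bar>) < \<epsilon>"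
    proof (intro exI[of _ "min \<delta> (2 * t * t)"] conjI allI impI)
      fix P assume P: "nonoverlapping a b P" and small: "(\<Sum>(c, d) \<in> P. s d - s c) < min \<delta> (2 * t * t)"
      show "(\<Sum>(c, d) \<in> P. \<bar>v d - v c\<bar>) < \<epsilon>"
      proof (cases "a \<le> b")
        case False
        then have "P = {}" using nonoverlappingD(2)[OF P] by fastforce
        then show ?thesis using \<open>\<epsilon> > 0\<close> by simp
      next
        case True
        have "(\<Sum>(c, d) \<in> P. \<bar>f n d - f n c\<bar>) \<le> 3 * t" for n
        proof -
          have "(\<Sum>(c, d) \<in> P. \<bar>f n d - f n c\<bar>) \<le>
             (\<Sum>(c, d) \<in> P. \<bar>(f n d - f 0 d) - (f n c - f 0 c)\<bar>) + (\<Sum>(c, d) \<in> P. \<bar>f 0 d - f 0 c\<bar>)"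
            unfolding sum.distrib[symmetric] by (rule sum_mono) auto
          moreover have "(\<Sum>(c, d) \<in> P. \<bar>(f n d - f 0 d) - (f n c - f 0 c)\<bar>) \<le> t + (\<Sum>(c, d)\<in>P. s d - s c) / (2 * t)"
            by (rule Fs_sum_increment_bound[OF Fs_diff[OF f(1) f(1)] f(2) \<open>t > 0\<close> P True])
          moreover have "(\<Sum>(c, d)\<in>P. s d - s c) / (2 * t) \<le> t" using small \<open>t > 0\<close> by (simp add: field_simps)
          ultimately show ?thesis using \<delta>(2)[OF P] small by simp
        qed
        moreover have "(\<lambda>n. \<Sum>(c, d) \<in> P. \<bar>f n d - f n c\<bar>) \<longlonglongrightarrow> (\<Sum>(c, d) \<in> P. \<bar>v d - v c\<bar>)"
          unfolding split_beta by (intro tendsto_intros f(3))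
        ultimately have "(\<Sum>(c, d) \<in> P. \<bar>v d - v c\<bar>) \<le> 3 * t"
          by (intro LIMSEQ_le_const2) auto
        then show ?thesis using \<open>\<epsilon> > 0\<close> by (simp add: t_def)
      qed
    qed (use \<delta> \<open>t > 0\<close> in auto)
  qed
qed

text \<open>
  The decay estimate holds uniformly along the approximating sequence, because it depends on the functions only through their
  energy.
\<close>
lemma Fse_vanishes_at_infinity:
  assumes v: "v \<in> Fse s"
  shows "(s \<longlongrightarrow> S) at_top \<Longrightarrow> (v \<longlongrightarrow> 0) at_top"
    and "(s \<longlongrightarrow> S) at_bot \<Longrightarrow> (v \<longlongrightarrow> 0) at_bot"
proof -
  obtain f where f: "\<And>n. f n \<in> Fs s" "\<And>n. (LINT x|lebesgue. (deriv (\<lambda>x. f n x - f 0 x) x)\<^sup>2) \<le> 2"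
    "\<And>x. (\<lambda>n. f n x) \<longlonglongrightarrow> v x" by (rule Fse_approximation[OF v]) (rule that)
  define D where "D = (LINT x|lebesgue. (deriv (f 0) x)\<^sup>2)"
  have bound: "\<bar>v x\<bar> \<le> t * (1 + D / 2) + B / t" if "t > 0"
    and B: "\<And>w. w \<in> Fs s \<Longrightarrow> \<bar>w x\<bar> \<le> t / 2 * (LINT x|lebesgue. (deriv w x)\<^sup>2) + B / (2 * t)" for x t B
  proof -
    have "\<bar>f n x\<bar> \<le> t * (1 + D / 2) + B / t" for n
    proof -
      have "t / 2 * (LINT x|lebesgue. (deriv (\<lambda>x. f n x - f 0 x) x)\<^sup>2) \<le> t / 2 * 2"
        using f(2)[of n] \<open>t > 0\<close> by (intro mult_left_mono) auto
      moreover have "\<bar>f n x - f 0 x\<bar> \<le> t / 2 * (LINT x|lebesgue. (deriv (\<lambda>x. f n x - f 0 x) x)\<^sup>2) + B / (2 * t)"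
        using B[OF Fs_diff[OF f(1) f(1)], of n 0] .
      moreover have "\<bar>f 0 x\<bar> \<le> t / 2 * D + B / (2 * t)" using B[OF f(1), of 0] by (simp add: D_def)
      moreover have "B / t = B / (2 * t) + B / (2 * t)" by simp
      ultimately show ?thesis by (simp add: algebra_simps)
    qed
    moreover have "(\<lambda>n. \<bar>f n x\<bar>) \<longlonglongrightarrow> \<bar>v x\<bar>" by (intro tendsto_rabs f(3))
    ultimately show ?thesis by (intro LIMSEQ_le_const2) auto
  qed
  show "(v \<longlongrightarrow> 0) at_top" if S: "(s \<longlongrightarrow> S) at_top"
  proof (rule tendsto_zero_tradeoff)
    have "s y \<le> S" for y
      by (rule tendsto_lowerbound[OF S]) (auto intro!: eventually_at_top_linorderI[of y] monoD[OF mono])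
    then show "\<bar>v x\<bar> \<le> t * (1 + D / 2) + (S - s x) / t" if "t > 0" for t x
      using that by (intro bound Fs_decay(1))
    show "((\<lambda>x. S - s x) \<longlongrightarrow> 0) at_top" using tendsto_diff[OF tendsto_const S, of S] by simp
  qed
  show "(v \<longlongrightarrow> 0) at_bot" if S: "(s \<longlongrightarrow> S) at_bot"
  proof (rule tendsto_zero_tradeoff)
    have "S \<le> s y" for y
      by (rule tendsto_upperbound[OF S]) (auto intro!: eventually_at_bot_linorderI[of y] monoD[OF mono])
    then show "\<bar>v x\<bar> \<le> t * (1 + D / 2) + (s x - S) / t" if "t > 0" for t x
      using that by (intro bound Fs_decay(2))
    show "((\<lambda>x. s x - S) \<longlongrightarrow> 0) at_bot" using tendsto_diff[OF S tendsto_const, of S] by simp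
  qed
qed

lemma Fs_subset_Fse: "v \<in> Fs s \<Longrightarrow> v \<in> Fse s"
proof -
  assume v: "v \<in> Fs s"
  have "abs_cont_wrt s (\<lambda>x. 0)" unfolding abs_cont_wrt_iff by (auto intro: exI[of _ 1])
  then have "Es s (\<lambda>x. v x - v x) (\<lambda>x. v x - v x) = 0" using Es_eq[of "\<lambda>x. 0"] by simp
  moreover have "continuous_on UNIV v"
    using v abs_cont_wrt_isCont[OF _ isCont] by (auto simp: Fs_iff intro!: continuous_at_imp_continuous_on)
  ultimately show ?thesis
    using v by (auto simp: Fse_def extended_dirichlet_space_def Fs_iff L2_def intro!: exI[of _ "\<lambda>_. v"])
qed

text \<open>
  Since \<open>v' = 0\<close> off \<open>G\<close>, the form is a multiple of \<open>\<integral> v'\<close>. If \<open>v'\<close> is not integrable, this Bochner integral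
  is zero by convention; otherwise it is the difference of the limits of \<open>v\<close> at \<open>\<plusminus>\<infinity>\<close>.
\<close>
lemma Eform_eq_0_of_constant_on_G:
  assumes u: "u \<in> H1e" and c: "AE x in lebesgue. x \<in> G \<longrightarrow> deriv u x = c" and v: "v \<in> Fse s"
  shows "Eform u v = 0"
proof -
  have vs: "abs_cont_wrt s v" using Fse_abs_cont[OF v] .
  have [measurable]: "deriv u \<in> borel_measurable lebesgue" "deriv v \<in> borel_measurable lebesgue"
    using u measurable_deriv[OF vs] by (auto simp: H1e_def L2_def)
  have "(LINT x|lebesgue. deriv u x * deriv v x) = (LINT x|lebesgue. c * deriv v x)"
  proof (rule integral_cong_AE)
    show "AE x in lebesgue. deriv u x * deriv v x = c * deriv v x"
      using c AE_deriv_eq_0[OF vs] by eventually_elim auto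
  qed measurable
  moreover have "c * (LINT x|lebesgue. deriv v x) = 0"
  proof (cases "c = 0 \<or> \<not> integrable lebesgue (deriv v)")
    case True
    then show ?thesis by (auto simp: not_integrable_integral_eq)
  next
    case False
    then have "c \<noteq> 0" and int: "integrable lebesgue (deriv v)" by auto
    \<comment> \<open>Chebyshev: \<open>1\<^sub>G \<le> u'\<^sup>2 / c\<^sup>2\<close>, so \<open>G\<close> has finite measure and \<open>s\<close> has finite limits.\<close>
    have "integrable lebesgue (\<lambda>x. indicator G x :: real)"
    proof (rule Bochner_Integration.integrable_bound)
      show "integrable lebesgue (\<lambda>x. (deriv u x)\<^sup>2 / c\<^sup>2)" using u by (auto simp: H1e_def L2_def)
      show "AE x in lebesgue. norm (indicator G x :: real) \<le> norm ((deriv u x)\<^sup>2 / c\<^sup>2)"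
        using c by eventually_elim (use \<open>c \<noteq> 0\<close> in \<open>auto simp: indicator_def\<close>)
      show "(\<lambda>x. indicator G x :: real) \<in> borel_measurable lebesgue"
        by (rule measurable_completion) measurable
    qed
    then obtain F where F: "\<And>a b. a \<le> b \<Longrightarrow> (indicat_real G has_integral F b - F a) {a..b}"
      "(F \<longlongrightarrow> 0) at_bot" "(F \<longlongrightarrow> (LINT x|lebesgue. indicat_real G x)) at_top"
      by (rule integrable_antiderivative) (rule that)
    have "s b - s a = F b - F a" if "a \<le> b" for a b
      using has_integral_unique[OF has_integral_indicator_G[OF that] F(1)[OF that]] .
    then have sF: "s = (\<lambda>x. F x + (s 0 - F 0))" by (rule equal_increments)
    have "(s \<longlongrightarrow> 0 + (s 0 - F 0)) at_bot" "(s \<longlongrightarrow> (LINT x|lebesgue. indicat_real G x) + (s 0 - F 0)) at_top"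
      by (subst sF, rule tendsto_add[OF F(2) tendsto_const], subst sF, rule tendsto_add[OF F(3) tendsto_const])
    then have v0: "(v \<longlongrightarrow> 0) at_bot" "(v \<longlongrightarrow> 0) at_top" using Fse_vanishes_at_infinity[OF v] by blast+
    obtain H where H: "\<And>a b. a \<le> b \<Longrightarrow> (deriv v has_integral H b - H a) {a..b}"
      "(H \<longlongrightarrow> 0) at_bot" "(H \<longlongrightarrow> (LINT x|lebesgue. deriv v x)) at_top"
      using int by (rule integrable_antiderivative) (rule that)
    have "H b - H a = v b - v a" if "a \<le> b" for a b
      using has_integral_unique[OF H(1)[OF that] abs_cont_FTC[OF abs_cont_trans[OF abs_cont vs] that]] .
    then have vH: "H = (\<lambda>x. v x + (H 0 - v 0))" by (rule equal_increments)
    have "(H \<longlongrightarrow> 0 + (H 0 - v 0)) at_bot" "(H \<longlongrightarrow> 0 + (H 0 - v 0)) at_top"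
      by (subst vH, rule tendsto_add[OF v0(1) tendsto_const], subst vH, rule tendsto_add[OF v0(2) tendsto_const])
    then have "H 0 - v 0 = 0" "(LINT x|lebesgue. deriv v x) = H 0 - v 0"
      using tendsto_unique[OF _ H(2)] tendsto_unique[OF _ H(3)] by fastforce+
    then show ?thesis by simp
  qed
  ultimately show ?thesis by (simp add: Eform_def)
qed

end

section \<open>Boundary terms at infinity\<close>

text \<open>
  A nonzero limit would give \<open>v\<^sup>2 \<ge> R/x\<close> for large \<open>x\<close>, and the integral of \<open>R/x\<close> diverges logarithmically.
\<close>
lemma limit_zero_of_sqrt_growth:
  fixes v W E :: "real \<Rightarrow> real"
  assumes E: "\<And>a b. a \<le> b \<Longrightarrow> ((\<lambda>x. (v x)\<^sup>2) has_integral E b - E a) {a..b}" "\<And>x. \<bar>E x\<bar> \<le> D"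
    and W: "\<And>x. x \<ge> 1 \<Longrightarrow> \<bar>W x\<bar> \<le> C * sqrt x"
    and lim: "((\<lambda>x. W x * v x) \<longlongrightarrow> L) at_top"
  shows "L = 0"
proof (rule ccontr)
  assume "L \<noteq> 0"
  define \<delta> where "\<delta> = \<bar>L\<bar> / 2"
  have "\<delta> > 0" using \<open>L \<noteq> 0\<close> by (simp add: \<delta>_def)
  have "((\<lambda>x. \<bar>W x * v x\<bar>) \<longlongrightarrow> \<bar>L\<bar>) at_top" using lim by (rule tendsto_rabs)
  then have "\<forall>\<^sub>F x in at_top. \<delta> < \<bar>W x * v x\<bar>"
    by (rule order_tendstoD) (use \<open>L \<noteq> 0\<close> in \<open>simp add: \<delta>_def\<close>)
  then obtain X0 where X0: "\<And>x. x \<ge> X0 \<Longrightarrow> \<delta> < \<bar>W x * v x\<bar>" by (auto simp: eventually_at_top_linorder)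
  define X where "X = max X0 1"
  have "X \<ge> 1" by (simp add: X_def)
  \<comment> \<open>The summand 1 keeps the divisor positive when \<open>C = 0\<close>.\<close>
  define K where "K = C\<^sup>2 + 1"
  have "K > 0" unfolding K_def by (simp add: add_nonneg_pos)
  have low: "\<delta>\<^sup>2 / K * (1 / x) \<le> (v x)\<^sup>2" if "x \<ge> X" for x
  proof -
    have "x \<ge> 1" "x > 0" using that \<open>X \<ge> 1\<close> by auto
    have "\<delta>\<^sup>2 \<le> \<bar>W x * v x\<bar>\<^sup>2" using X0[of x] that \<open>\<delta> > 0\<close> by (intro power_mono) (auto simp: X_def)
    also have "\<dots> = \<bar>W x\<bar>\<^sup>2 * (v x)\<^sup>2" by (simp add: power_mult_distrib abs_mult)
    also have "\<dots> \<le> (C * sqrt x)\<^sup>2 * (v x)\<^sup>2"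
      using W[OF \<open>x \<ge> 1\<close>] by (intro mult_right_mono power_mono) auto
    also have "\<dots> = C\<^sup>2 * x * (v x)\<^sup>2" using \<open>x > 0\<close> by (simp add: power_mult_distrib)
    also have "\<dots> \<le> K * x * (v x)\<^sup>2" using \<open>x > 0\<close> by (intro mult_right_mono) (auto simp: K_def)
    finally show ?thesis using \<open>K > 0\<close> \<open>x > 0\<close> by (simp add: field_simps)
  qed
  define R where "R = \<delta>\<^sup>2 / K"
  have "R > 0" using \<open>\<delta> > 0\<close> \<open>K > 0\<close> by (simp add: R_def)
  have "R * (ln B - ln X) \<le> 2 * D" if "B \<ge> X" for B
  proof -
    have "((\<lambda>x. 1 / x) has_integral ln B - ln X) {X..B}"
      by (rule fundamental_theorem_of_calculus[OF that])
        (use \<open>X \<ge> 1\<close> in \<open>auto simp: has_real_derivative_iff_has_vector_derivative[symmetric] intro!: derivative_eq_intros\<close>)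
    then have "((\<lambda>x. R * (1 / x)) has_integral R * (ln B - ln X)) {X..B}" by (rule has_integral_mult_right)
    then have "R * (ln B - ln X) \<le> E B - E X"
      by (rule has_integral_le[OF _ E(1)[OF that]]) (use low in \<open>auto simp: R_def\<close>)
    then show ?thesis using E(2)[of B] E(2)[of X] by linarith
  qed
  then have le: "ln B \<le> ln X + 2 * D / R" if "B \<ge> X" for B
    using \<open>R > 0\<close> that by (simp add: field_simps)
  \<comment> \<open>The logarithm of this point exceeds the bound.\<close>
  define B where "B = max X (exp (ln X + 2 * D / R + 1))"
  have "ln X + 2 * D / R + 1 \<le> ln B"
    by (subst ln_ge_iff) (auto simp: B_def less_max_iff_disj)
  then show False using le[of B] by (simp add: B_def)
qed

text \<open>
  By Cauchy-Schwarz \<open>\<bar>\<integral>\<^sub>0\<^sup>x u\<bar> \<le> \<surd>x \<parallel>u\<parallel>\<close>; the proof integrates the pointwise inequality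
  \<open>\<bar>a\<bar> \<le> \<surd>x a\<^sup>2/2 + 1/(2 \<surd>x)\<close>.
\<close>
lemma antiderivative_L2_sqrt_growth:
  fixes W u E :: "real \<Rightarrow> real"
  assumes W: "\<And>x. (W has_real_derivative \<alpha> * u x) (at x)"
    and E: "\<And>a b. a \<le> b \<Longrightarrow> ((\<lambda>x. (u x)\<^sup>2) has_integral E b - E a) {a..b}" "\<And>x. \<bar>E x\<bar> \<le> D"
    and "x \<ge> 1"
  shows "\<bar>W x\<bar> \<le> (\<bar>W 0\<bar> + \<bar>\<alpha>\<bar> * (D + 1)) * sqrt x"
proof -
  have sx: "sqrt x \<ge> 1" using \<open>x \<ge> 1\<close> by simp
  have I: "((\<lambda>y. \<alpha> * u y) has_integral W x - W 0) {0..x}"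
    by (rule fundamental_theorem_of_calculus)
      (use \<open>x \<ge> 1\<close> W in \<open>auto simp: has_real_derivative_iff_has_vector_derivative[symmetric] intro: has_field_derivative_at_within\<close>)
  have r: "((\<lambda>y. \<bar>\<alpha>\<bar> * (sqrt x / 2 * (u y)\<^sup>2 + 1 / (2 * sqrt x))) has_integral
      \<bar>\<alpha>\<bar> * (sqrt x / 2 * (E x - E 0) + 1 / (2 * sqrt x) * x)) {0..x}"
  proof (intro has_integral_mult_right has_integral_add E(1))
    show "((\<lambda>y. 1 / (2 * sqrt x)) has_integral 1 / (2 * sqrt x) * x) {0..x}"
      using has_integral_const_real[of "1 / (2 * sqrt x)" 0 x] \<open>x \<ge> 1\<close> by simp
  qed (use \<open>x \<ge> 1\<close> in simp)
  have "\<bar>u y\<bar> \<le> sqrt x / 2 * (u y)\<^sup>2 + 1 / (2 * sqrt x)" for y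
  proof -
    have "0 \<le> (sqrt x * \<bar>u y\<bar> - 1)\<^sup>2" by simp
    also have "\<dots> = (sqrt x)\<^sup>2 * (u y)\<^sup>2 + 1 - 2 * sqrt x * \<bar>u y\<bar>"
      by (simp add: power2_diff power_mult_distrib)
    finally have "\<bar>u y\<bar> \<le> ((sqrt x)\<^sup>2 * (u y)\<^sup>2 + 1) / (2 * sqrt x)" using sx by (simp add: pos_le_divide_eq mult.commute mult.left_commute)
    also have "\<dots> = sqrt x / 2 * (u y)\<^sup>2 + 1 / (2 * sqrt x)"
    proof -
      have "(r\<^sup>2 * a + 1) / (2 * r) = r / 2 * a + 1 / (2 * r)" if "r > 0" for r a :: real
        using that by (simp add: field_simps power2_eq_square)
      then show ?thesis using sx by (metis less_le_trans zero_less_one)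
    qed
    finally show ?thesis .
  qed
  then have "norm (integral {0..x} (\<lambda>y. \<alpha> * u y)) \<le> integral {0..x} (\<lambda>y. \<bar>\<alpha>\<bar> * (sqrt x / 2 * (u y)\<^sup>2 + 1 / (2 * sqrt x)))"
    using I r by (intro integral_norm_bound_integral) (auto simp: abs_mult intro!: mult_left_mono)
  then have "\<bar>W x - W 0\<bar> \<le> \<bar>\<alpha>\<bar> * (sqrt x / 2 * (E x - E 0) + 1 / (2 * sqrt x) * x)"
    by (simp only: integral_unique[OF I] integral_unique[OF r] real_norm_def)
  also have "1 / (2 * sqrt x) * x = sqrt x / 2"
    using \<open>x \<ge> 1\<close> real_div_sqrt[of x] by simp
  also have "sqrt x / 2 * (E x - E 0) + sqrt x / 2 \<le> (D + 1) * sqrt x"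
  proof -
    have "E x - E 0 \<le> 2 * D" using E(2)[of x] E(2)[of 0] by linarith
    then have "sqrt x / 2 * (E x - E 0) \<le> sqrt x / 2 * (2 * D)" using sx by (intro mult_left_mono) auto
    moreover have "sqrt x / 2 * (2 * D) + sqrt x = (D + 1) * sqrt x" by (simp add: algebra_simps)
    ultimately show ?thesis using sx by linarith
  qed
  finally have "\<bar>W x - W 0\<bar> \<le> \<bar>\<alpha>\<bar> * ((D + 1) * sqrt x)" by (simp add: mult_left_mono)
  moreover have "\<bar>W 0\<bar> \<le> \<bar>W 0\<bar> * sqrt x" using sx by (simp add: mult_le_cancel_left1)
  ultimately show ?thesis by (simp add: algebra_simps)
qed

text \<open>
  The limit at \<open>-\<infinity>\<close> is reduced to the one at \<open>+\<infinity>\<close> by reflection, under which the cumulative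
  square integrals turn into \<open>- E (- x)\<close>.
\<close>
lemma limits_zero_of_L2:
  fixes W u v :: "real \<Rightarrow> real"
  assumes W: "\<And>x. (W has_real_derivative \<alpha> * u x) (at x)" and u: "u \<in> L2 lebesgue" and v: "v \<in> L2 lebesgue"
  shows "((\<lambda>x. W x * v x) \<longlongrightarrow> L) at_top \<Longrightarrow> L = 0"
    and "((\<lambda>x. W x * v x) \<longlongrightarrow> L) at_bot \<Longrightarrow> L = 0"
proof -
  have *: "\<exists>E D. (\<forall>a b. a \<le> b \<longrightarrow> ((\<lambda>x. (g x)\<^sup>2) has_integral E b - E a) {a..b}) \<and> (\<forall>x. \<bar>E x\<bar> \<le> D)"
    if g: "g \<in> L2 lebesgue" for g
  proof -
    obtain E where "mono E" "\<And>x. 0 \<le> E x" "\<And>x. E x \<le> (LINT x|lebesgue. (g x)\<^sup>2)"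
      "\<And>a b. a \<le> b \<Longrightarrow> ((\<lambda>x. (g x)\<^sup>2) has_integral E b - E a) {a..b}"
      by (rule L2_energy[OF g]) (rule that)
    then show ?thesis by (intro exI[of _ E] exI[of _ "LINT x|lebesgue. (g x)\<^sup>2"]) auto
  qed
  obtain E D where E: "\<And>a b. a \<le> b \<Longrightarrow> ((\<lambda>x. (u x)\<^sup>2) has_integral E b - E a) {a..b}" "\<And>x. \<bar>E x\<bar> \<le> D"
    using *[OF u] by blast
  obtain E' D' where E': "\<And>a b. a \<le> b \<Longrightarrow> ((\<lambda>x. (v x)\<^sup>2) has_integral E' b - E' a) {a..b}" "\<And>x. \<bar>E' x\<bar> \<le> D'"
    using *[OF v] by blast
  have reflect: "((\<lambda>x. (g (- x))\<^sup>2) has_integral (- H (- b)) - (- H (- a))) {a..b}"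
    if "a \<le> b" "\<And>a b. a \<le> b \<Longrightarrow> ((\<lambda>x. (g x)\<^sup>2) has_integral H b - H a) {a..b}" for a b and g H :: "real \<Rightarrow> real"
  proof -
    have "((\<lambda>x. (g x)\<^sup>2) has_integral H (- a) - H (- b)) {- b..- a}" using that by simp
    then show ?thesis using has_integral_reflect_real[of "\<lambda>x. (g x)\<^sup>2" "H (- a) - H (- b)" "- a" "- b"] by simp
  qed
  show "L = 0" if "((\<lambda>x. W x * v x) \<longlongrightarrow> L) at_top"
    using limit_zero_of_sqrt_growth[OF E' antiderivative_L2_sqrt_growth[OF W E] that] .
  show "L = 0" if "((\<lambda>x. W x * v x) \<longlongrightarrow> L) at_bot"
  proof (rule limit_zero_of_sqrt_growth[of "\<lambda>x. v (- x)" "\<lambda>x. - E' (- x)" D' "\<lambda>x. W (- x)"])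
    show "((\<lambda>x. W (- x) * v (- x)) \<longlongrightarrow> L) at_top" using that by (simp add: filterlim_at_bot_mirror)
    show "((\<lambda>x. (v (- x))\<^sup>2) has_integral - E' (- b) - - E' (- a)) {a..b}" if "a \<le> b" for a b
      by (rule reflect[OF that E'(1)])
    show "\<bar>- E' (- x)\<bar> \<le> D'" for x using E'(2) by simp
    fix x :: real assume "x \<ge> 1"
    have dW: "((\<lambda>x. W (- x)) has_real_derivative (- \<alpha>) * u (- x)) (at x)" for x
      using W[of "- x"] DERIV_mirror[of W "\<alpha> * u (- x)" x] by simp
    show "\<bar>W (- x)\<bar> \<le> (\<bar>W (- 0)\<bar> + \<bar>- \<alpha>\<bar> * (D + 1)) * sqrt x"
      by (rule antiderivative_L2_sqrt_growth[OF dW reflect[OF _ E(1)] _ \<open>x \<ge> 1\<close>]) (use E(2) in auto)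
  qed
qed

section \<open>Test functions climbing inside the open set\<close>

text \<open>
  The ramp climbs linearly from \<open>0\<close> to \<open>1\<close> along \<open>[c, d]\<close>, so the integral of a function against its derivative is a
  mean value over \<open>[c, d]\<close>.
\<close>
definition ramp :: "real \<Rightarrow> real \<Rightarrow> real \<Rightarrow> real" where
  "ramp c d x = (max c (min d x) - c) / (d - c)"

lemma ramp_has_derivative:
  assumes "c < d" "x \<noteq> c" "x \<noteq> d"
  shows "(ramp c d has_real_derivative indicator {c..d} x / (d - c)) (at x)"
proof -
  consider "x < c" | "c < x" "x < d" | "d < x" using assms by linarith
  then show ?thesis
  proof cases
    case 1
    have "((\<lambda>x. 0) has_real_derivative 0) (at x)" by simp
    then have "(ramp c d has_real_derivative 0) (at x)"
      by (rule has_field_derivative_transform_within_open[of _ _ _ "{..<c}"]) (use 1 assms in \<open>auto simp: ramp_def\<close>)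
    then show ?thesis using 1 by simp
  next
    case 2
    have "((\<lambda>x. (x - c) / (d - c)) has_real_derivative 1 / (d - c)) (at x)"
      using \<open>c < d\<close> by (auto intro!: derivative_eq_intros)
    then have "(ramp c d has_real_derivative 1 / (d - c)) (at x)"
      by (rule has_field_derivative_transform_within_open[of _ _ _ "{c<..<d}"]) (use 2 in \<open>auto simp: ramp_def\<close>)
    then show ?thesis using 2 by simp
  next
    case 3
    have "((\<lambda>x. 1) has_real_derivative 0) (at x)" by simp
    then have "(ramp c d has_real_derivative 0) (at x)"
      by (rule has_field_derivative_transform_within_open[of _ _ _ "{d<..}"]) (use 3 assms in \<open>auto simp: ramp_def\<close>)
    then show ?thesis using 3 by simp
  qed
qed

lemma ramp_continuous: "continuous_on A (ramp c d)"
  unfolding ramp_def by (cases "c = d") (auto intro!: continuous_intros)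

lemma has_integral_mult_indicator_slope:
  fixes f F :: "real \<Rightarrow> real"
  assumes "\<And>a b. a \<le> b \<Longrightarrow> (f has_integral F b - F a) {a..b}" and "c < d"
  shows "((\<lambda>x. f x * (indicator {c..d} x / (d - c))) has_integral (F d - F c) / (d - c)) UNIV"
proof -
  have "((\<lambda>x. if x \<in> {c..d} then f x else 0) has_integral F d - F c) UNIV"
    using assms has_integral_restrict_UNIV[of "{c..d}" f "F d - F c"] by simp
  then have "((\<lambda>x. (if x \<in> {c..d} then f x else 0) / (d - c)) has_integral (F d - F c) / (d - c)) UNIV"
    by (rule has_integral_divide)
  moreover have "(\<lambda>x. (if x \<in> {c..d} then f x else 0) / (d - c)) = (\<lambda>x. f x * (indicator {c..d} x / (d - c)))"
    by (auto simp: indicator_def)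
  ultimately show ?thesis by simp
qed

lemma indicator_slope_L2: "(\<lambda>x. indicator {c..d} x / k) \<in> L2 lebesgue" for c d k :: real
proof -
  have "integrable lborel (\<lambda>x. indicator {c..d} x * (1 / k)\<^sup>2 :: real)"
    by (intro integrable_mult_left integrable_real_indicator) (auto simp: emeasure_lborel_Icc_eq)
  moreover have "(\<lambda>x. indicator {c..d} x * (1 / k)\<^sup>2) = (\<lambda>x. (indicator {c..d} x / k)\<^sup>2 :: real)"
    by (auto simp: indicator_def)
  ultimately have "integrable lborel (\<lambda>x. (indicator {c..d} x / k)\<^sup>2 :: real)" by simp
  then have "integrable lebesgue (\<lambda>x. (indicator {c..d} x / k)\<^sup>2 :: real)"
    by (subst integrable_completion) auto
  moreover have "(\<lambda>x. indicator {c..d} x / k) \<in> borel_measurable lebesgue"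
    by (rule measurable_completion) simp
  ultimately show ?thesis by (simp add: L2_def)
qed

lemma integrable_compact_support:
  fixes f :: "real \<Rightarrow> real"
  assumes "continuous_on UNIV f" "\<And>x. x \<notin> {A..B} \<Longrightarrow> f x = 0"
  shows "integrable lebesgue f"
proof -
  have "set_integrable lebesgue {A..B} f"
    using absolutely_integrable_continuous_real[of A B f] assms(1) continuous_on_subset by blast
  moreover have "(\<lambda>x. indicator {A..B} x *\<^sub>R f x) = f"
    by (rule ext) (use assms(2) in \<open>auto simp: indicator_def\<close>)
  ultimately show ?thesis by (simp add: set_integrable_def)
qed

context scaling_function
begin

lemma Lipschitz_imp_abs_cont_wrt:
  assumes "K > 0" "\<And>x y. x < y \<Longrightarrow> \<bar>v y - v x\<bar> \<le> K * (s y - s x)"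
  shows "abs_cont_wrt s v"
  unfolding abs_cont_wrt_iff
proof (intro allI impI)
  fix a b \<epsilon> :: real assume "\<epsilon> > 0"
  show "\<exists>\<delta>>0. \<forall>P. nonoverlapping a b P \<longrightarrow> (\<Sum>(c, d) \<in> P. s d - s c) < \<delta> \<longrightarrow> (\<Sum>(c, d) \<in> P. \<bar>v d - v c\<bar>) < \<epsilon>"
  proof (intro exI[of _ "\<epsilon> / K"] conjI allI impI)
    fix P assume P: "nonoverlapping a b P" "(\<Sum>(c, d) \<in> P. s d - s c) < \<epsilon> / K"
    have "(\<Sum>(c, d) \<in> P. \<bar>v d - v c\<bar>) \<le> (\<Sum>(c, d) \<in> P. K * (s d - s c))"
      by (rule sum_mono) (use assms(2) nonoverlappingD(2)[OF P(1)] in force)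
    also have "\<dots> = K * (\<Sum>(c, d) \<in> P. s d - s c)" by (simp add: split_beta sum_distrib_left)
    also have "\<dots> < \<epsilon>" using P(2) \<open>K > 0\<close> by (simp add: field_simps)
    finally show "(\<Sum>(c, d) \<in> P. \<bar>v d - v c\<bar>) < \<epsilon>" .
  qed (use \<open>K > 0\<close> \<open>\<epsilon> > 0\<close> in simp)
qed

lemma s_increment_in_G:
  assumes "{p..q} \<subseteq> G" "p \<le> q"
  shows "s q - s p = q - p"
proof -
  have "((\<lambda>x. 1) has_integral s q - s p) {p..q}"
    by (rule has_integral_eq[OF _ has_integral_indicator_G[OF \<open>p \<le> q\<close>]]) (use assms in auto)
  then show ?thesis using has_integral_const_real[of "1::real" p q] \<open>p \<le> q\<close>
    by (metis content_real has_integral_unique mult.right_neutral real_scaleR_def)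
qed

text \<open>
  A ramp moves only inside \<open>[c, d] \<subseteq> G\<close>, where \<open>s\<close> has slope \<open>1\<close>.
\<close>
lemma ramp_Lipschitz:
  assumes "{c..d} \<subseteq> G" "c < d" "x < y"
  shows "\<bar>ramp c d y - ramp c d x\<bar> \<le> 1 / (d - c) * (s y - s x)"
proof -
  define p where "p = max c (min d x)"
  define q where "q = max c (min d y)"
  have pq: "c \<le> p" "p \<le> q" "q \<le> d" using assms by (auto simp: p_def q_def)
  have "{p..q} \<subseteq> {c..d}" using pq by auto
  then have e: "s q - s p = q - p" using s_increment_in_G[of p q] pq assms(1) by blast
  have "s q - s p \<le> s y - s x"
  proof (cases "p = q")
    case True
    then show ?thesis using monoD[OF mono, of x y] assms by simp
  next
    case False
    then have "x \<le> p" "q \<le> y" using assms by (auto simp: p_def q_def min_def max_def split: if_splits)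
    then show ?thesis using monoD[OF mono, of x p] monoD[OF mono, of q y] by linarith
  qed
  moreover have "ramp c d y - ramp c d x = (q - p) / (d - c)"
    by (simp add: ramp_def p_def q_def diff_divide_distrib)
  ultimately show ?thesis using e pq \<open>c < d\<close> by (simp add: divide_right_mono)
qed

text \<open>
  A single ramp is not square integrable; the difference of two of them has compact support.
\<close>
lemma ramp_difference_in_Fs:
  assumes cd: "{c..d} \<subseteq> G" "c < d" and cd': "{c'..d'} \<subseteq> G" "c' < d'"
  defines "v \<equiv> \<lambda>x. ramp c d x - ramp c' d' x"
  shows "v \<in> Fs s"
    and "AE x in lebesgue. deriv v x = indicator {c..d} x / (d - c) - indicator {c'..d'} x / (d' - c')"
    and "x \<notin> {min c c'<..<max d d'} \<Longrightarrow> v x = 0"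
    and "continuous_on UNIV v"
proof -
  have out: "v y = 0" if "y \<notin> {min c c'<..<max d d'}" for y
    using that cd(2) cd'(2) by (auto simp: v_def ramp_def min_def max_def split: if_splits)
  then show "x \<notin> {min c c'<..<max d d'} \<Longrightarrow> v x = 0" .
  show cont: "continuous_on UNIV v" unfolding v_def by (intro continuous_intros ramp_continuous)
  show ae: "AE x in lebesgue. deriv v x = indicator {c..d} x / (d - c) - indicator {c'..d'} x / (d' - c')"
    unfolding AE_lebesgue_iff_negligible
  proof (rule negligible_subset)
    show "negligible {c, d, c', d'}" by simp
    have "deriv v x = indicator {c..d} x / (d - c) - indicator {c'..d'} x / (d' - c')" if "x \<notin> {c, d, c', d'}" for x
      unfolding v_def by (rule DERIV_imp_deriv, rule DERIV_diff) (use that cd cd' in \<open>auto intro!: ramp_has_derivative\<close>)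
    then show "{x. deriv v x \<noteq> indicator {c..d} x / (d - c) - indicator {c'..d'} x / (d' - c')} \<subseteq> {c, d, c', d'}"
      by blast
  qed
  have "(v \<in> L2 lebesgue)"
  proof -
    have "v \<in> borel_measurable lebesgue"
      using cont by (intro measurable_completion) (simp add: borel_measurable_continuous_onI)
    moreover have "integrable lebesgue (\<lambda>x. (v x)\<^sup>2)"
    proof (rule integrable_compact_support[of _ "min c c'" "max d d'"])
      show "continuous_on UNIV (\<lambda>x. (v x)\<^sup>2)" using cont by (intro continuous_intros)
      show "(v x)\<^sup>2 = 0" if "x \<notin> {min c c'..max d d'}" for x
      proof -
        have "x \<notin> {min c c'<..<max d d'}" using that by auto
        then show ?thesis using out by simp
      qed
    qed
    ultimately show ?thesis by (simp add: L2_def)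
  qed
  moreover have "abs_cont_wrt s v"
  proof (rule Lipschitz_imp_abs_cont_wrt)
    show "1 / (d - c) + 1 / (d' - c') > 0" using cd cd' by (simp add: add_pos_pos)
    fix x y :: real assume "x < y"
    then show "\<bar>v y - v x\<bar> \<le> (1 / (d - c) + 1 / (d' - c')) * (s y - s x)"
      using ramp_Lipschitz[OF cd] ramp_Lipschitz[OF cd'] unfolding v_def distrib_right by (smt (verit))
  qed
  moreover have "deriv v \<in> L2 lebesgue"
    by (rule L2_cong_AE[OF L2_diff[OF indicator_slope_L2 indicator_slope_L2]]) (use ae in \<open>auto elim: eventually_mono\<close>)
  ultimately show "v \<in> Fs s" by (simp add: Fs_iff)
qed

text \<open>
  Orthogonality to differences of ramps says that \<open>\<Phi> = u - 2 \<alpha> V\<close>, with \<open>V'' = u\<close>, has the same slope over all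
  intervals inside \<open>G\<close>; its derivative exists almost everywhere and is then this slope.
\<close>
theorem orthogonal_imp_affine_on_G:
  assumes u: "u \<in> H1e" and orth: "\<And>v. v \<in> Fs s \<Longrightarrow> Eform_alpha \<alpha> u v = 0"
    and U: "\<And>x. (U has_real_derivative u x) (at x)"
  shows "\<exists>c. AE x in lebesgue. x \<in> G \<longrightarrow> deriv u x - 2 * \<alpha> * U x = c"
proof -
  have ac: "abs_cont u" and L2: "deriv u \<in> L2 lebesgue" using u by (auto simp: H1e_def)
  have cu: "continuous_on UNIV u" using abs_cont_continuous[OF ac] .
  have "continuous_on UNIV U" using U by (meson DERIV_isCont continuous_at_imp_continuous_on)
  then obtain V where V: "\<And>x. (V has_real_derivative U x) (at x)" using antiderivative_exists by blast
  have Vint: "(U has_integral V b - V a) {a..b}" if "a \<le> b" for a b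
    by (rule fundamental_theorem_of_calculus[OF that])
      (use V in \<open>auto simp: has_real_derivative_iff_has_vector_derivative[symmetric] intro: has_field_derivative_at_within\<close>)
  define \<Phi> where "\<Phi> x = u x - 2 * \<alpha> * V x" for x
  have \<Phi>: "((\<lambda>x. deriv u x - 2 * \<alpha> * U x) has_integral \<Phi> b - \<Phi> a) {a..b}" if "a \<le> b" for a b
    using has_integral_diff[OF abs_cont_FTC[OF ac that] has_integral_mult_right[OF Vint[OF that], of "2 * \<alpha>"]]
    by (simp add: \<Phi>_def algebra_simps)
  have slope: "(\<Phi> d - \<Phi> c) / (d - c) = (\<Phi> d' - \<Phi> c') / (d' - c')"
    if cd: "{c..d} \<subseteq> G" "c < d" and cd': "{c'..d'} \<subseteq> G" "c' < d'" for c d c' d'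
  proof -
    define v where "v x = ramp c d x - ramp c' d' x" for x
    define g where "g x = indicator {c..d} x / (d - c) - indicator {c'..d'} x / (d' - c')" for x :: real
    define A where "A = min c c'"
    define B where "B = max d d'"
    have "A \<le> B" using cd cd' by (auto simp: A_def B_def)
    note vF = ramp_difference_in_Fs[OF cd cd', folded v_def[abs_def]]
    have vFs: "v \<in> Fs s" and ae: "AE x in lebesgue. deriv v x = g x" and cv: "continuous_on UNIV v"
      using vF by (simp_all add: g_def)
    have out: "v x = 0" if "x \<notin> {A<..<B}" for x using vF(3)[of x] that by (simp add: A_def B_def v_def)
    have acv: "abs_cont v" using vFs abs_cont_trans[OF abs_cont] by (auto simp: Fs_iff)
    have neg: "negligible {x. \<not> deriv v x = g x}" using ae by (simp only: AE_lebesgue_iff_negligible)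
    have slope_int: "((\<lambda>x. f x * g x) has_integral (F d - F c) / (d - c) - (F d' - F c') / (d' - c')) UNIV"
      if "\<And>a b. a \<le> b \<Longrightarrow> (f has_integral F b - F a) {a..b}" for f F
      using has_integral_diff[OF has_integral_mult_indicator_slope[OF that \<open>c < d\<close>] has_integral_mult_indicator_slope[OF that \<open>c' < d'\<close>]]
      by (simp add: g_def algebra_simps)
    \<comment> \<open>The first part of the form is a difference of means of \<open>u'\<close>.\<close>
    have "integrable lebesgue (\<lambda>x. deriv u x * deriv v x)"
      using L2 vFs by (intro L2_mult_integrable) (auto simp: Fs_iff)
    then have "((\<lambda>x. deriv u x * deriv v x) has_integral (LINT x|lebesgue. deriv u x * deriv v x)) UNIV"
      by (rule has_integral_integral_lebesgue)
    moreover have "((\<lambda>x. deriv u x * deriv v x) has_integral ((u d - u c) / (d - c) - (u d' - u c') / (d' - c'))) UNIV"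
      by (rule has_integral_spike[OF neg _ slope_int[OF abs_cont_FTC[OF ac]]]) auto
    ultimately have 1: "(LINT x|lebesgue. deriv u x * deriv v x) = (u d - u c) / (d - c) - (u d' - u c') / (d' - c')"
      by (rule has_integral_unique)
    \<comment> \<open>The second part becomes a difference of means of \<open>U\<close>; the boundary terms vanish since \<open>v A = v B = 0\<close>.\<close>
    have "((\<lambda>x. u x * v x + U x * deriv v x) has_integral U B * v B - U A * v A) {A..B}"
      by (rule product_rule_has_integral[OF U cu acv \<open>A \<le> B\<close>])
    then have "((\<lambda>x. if x \<in> {A..B} then u x * v x + U x * deriv v x else 0) has_integral 0) UNIV"
      using out by (subst has_integral_restrict_UNIV) simp
    moreover have "u x * v x + U x * g x = (if x \<in> {A..B} then u x * v x + U x * deriv v x else 0)"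
      if "x \<in> UNIV - {x. \<not> deriv v x = g x}" for x
    proof -
      have "g x = 0" if "x \<notin> {A..B}" using that by (auto simp: g_def A_def B_def indicator_def)
      then show ?thesis using that out[of x] by auto
    qed
    ultimately have "((\<lambda>x. u x * v x + U x * g x) has_integral 0) UNIV"
      by (elim has_integral_spike[OF neg, rotated]) blast
    from has_integral_diff[OF this slope_int[OF Vint]]
    have "((\<lambda>x. u x * v x) has_integral - ((V d - V c) / (d - c) - (V d' - V c') / (d' - c'))) UNIV" by simp
    moreover have "integrable lebesgue (\<lambda>x. u x * v x)"
      by (rule integrable_compact_support[of _ A B]) (use out in \<open>auto intro!: continuous_intros cu cv\<close>)
    then have "((\<lambda>x. u x * v x) has_integral (LINT x|lebesgue. u x * v x)) UNIV"
      by (rule has_integral_integral_lebesgue)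
    ultimately have 2: "(LINT x|lebesgue. u x * v x) = - ((V d - V c) / (d - c) - (V d' - V c') / (d' - c'))"
      by (rule has_integral_unique[rotated])
    have arith: "p - 2 * \<alpha> * q = p' - 2 * \<alpha> * q'" if "1/2 * (p - p') + \<alpha> * (- (q - q')) = 0" for p p' q q'
    proof -
      have "(p - 2 * \<alpha> * q) - (p' - 2 * \<alpha> * q') = 2 * (1/2 * (p - p') + \<alpha> * (- (q - q')))"
        by (simp add: field_simps)
      then show ?thesis unfolding that by simp
    qed
    have "Eform_alpha \<alpha> u v = 0" using orth[OF vFs] .
    then have "(u d - u c) / (d - c) - 2 * \<alpha> * ((V d - V c) / (d - c)) = (u d' - u c') / (d' - c') - 2 * \<alpha> * ((V d' - V c') / (d' - c'))"
      unfolding Eform_alpha_def Eform_def 1 2 by (rule arith)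
    moreover have "(\<Phi> y - \<Phi> x) / (y - x) = (u y - u x) / (y - x) - 2 * \<alpha> * ((V y - V x) / (y - x))" for x y
      by (simp add: \<Phi>_def diff_divide_distrib[symmetric] algebra_simps)
    ultimately show ?thesis by simp
  qed
  have "\<exists>c0. \<forall>c d. {c..d} \<subseteq> G \<longrightarrow> c < d \<longrightarrow> \<Phi> d - \<Phi> c = c0 * (d - c)"
  proof (cases "\<exists>c' d'. {c'..d'} \<subseteq> G \<and> c' < d'")
    case True
    then obtain c' d' where "{c'..d'} \<subseteq> G" "c' < d'" by blast
    then show ?thesis
      using slope by (intro exI[of _ "(\<Phi> d' - \<Phi> c') / (d' - c')"]) (metis diff_gt_0_iff_gt less_irrefl nonzero_eq_divide_eq)
  qed auto
  then obtain c0 where c0: "\<And>c d. {c..d} \<subseteq> G \<Longrightarrow> c < d \<Longrightarrow> \<Phi> d - \<Phi> c = c0 * (d - c)" by blast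
  have der: "(\<Phi> has_real_derivative c0) (at x)" if x: "x \<in> G" for x
  proof -
    obtain e where e: "e > 0" "ball x e \<subseteq> G" using openE[OF open_G x] by blast
    have "((\<lambda>y. \<Phi> x + c0 * (y - x)) has_real_derivative c0) (at x)"
      by (auto intro!: derivative_eq_intros)
    then show ?thesis
    proof (rule has_field_derivative_transform_within_open[of _ _ _ "ball x e"])
      fix y assume y: "y \<in> ball x e"
      have "{min x y..max x y} \<subseteq> ball x e" using y \<open>e > 0\<close> by (auto simp: dist_real_def)
      then have "{min x y..max x y} \<subseteq> G" using e by blast
      then show "\<Phi> x + c0 * (y - x) = \<Phi> y"
        using c0[of x y] c0[of y x] by (cases x y rule: linorder_cases) (auto simp: algebra_simps)
    qed (use e in auto)
  qed
  have "AE x in lebesgue. (\<Phi> has_real_derivative deriv u x - 2 * \<alpha> * U x) (at x)"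
    by (rule AE_has_real_derivative_of_has_integral[OF \<Phi>])
  then have "AE x in lebesgue. x \<in> G \<longrightarrow> deriv u x - 2 * \<alpha> * U x = c0"
    by eventually_elim (use der DERIV_unique in blast)
  then show ?thesis by blast
qed

text \<open>
  With \<open>W = \<alpha> U + c/2\<close> the integrand of the form is the derivative of \<open>W v\<close>, and \<open>W v\<close> vanishes at \<open>\<plusminus>\<infinity>\<close>.
\<close>
theorem affine_on_G_imp_orthogonal:
  assumes u: "u \<in> H1" and U: "\<And>x. (U has_real_derivative u x) (at x)"
    and c: "AE x in lebesgue. x \<in> G \<longrightarrow> deriv u x - 2 * \<alpha> * U x = c" and v: "v \<in> Fs s"
  shows "Eform_alpha \<alpha> u v = 0"
proof -
  have ac: "abs_cont u" and u2: "u \<in> L2 lebesgue" "deriv u \<in> L2 lebesgue" using u by (auto simp: H1_def)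
  have vs: "abs_cont_wrt s v" and v2: "v \<in> L2 lebesgue" "deriv v \<in> L2 lebesgue" using v by (auto simp: Fs_iff)
  have acv: "abs_cont v" using abs_cont_trans[OF abs_cont vs] .
  \<comment> \<open>Chosen so that \<open>u' = 2 W\<close> on \<open>G\<close> and \<open>W' = \<alpha> u\<close> everywhere.\<close>
  define W where "W x = \<alpha> * U x + c / 2" for x
  have W: "(W has_real_derivative \<alpha> * u x) (at x)" for x
    unfolding W_def by (auto intro!: derivative_eq_intros U)
  have cW: "continuous_on UNIV (\<lambda>x. \<alpha> * u x)" by (intro continuous_intros abs_cont_continuous ac)
  define f where "f x = 1/2 * (deriv u x * deriv v x) + \<alpha> * (u x * v x)" for x
  have i: "integrable lebesgue (\<lambda>x. deriv u x * deriv v x)" "integrable lebesgue (\<lambda>x. u x * v x)"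
    using L2_mult_integrable u2 v2 by blast+
  have f: "integrable lebesgue f" unfolding f_def using i by auto
  have E: "Eform_alpha \<alpha> u v = (LINT x|lebesgue. f x)"
    unfolding Eform_alpha_def Eform_def f_def using i by simp
  obtain F where F: "\<And>a b. a \<le> b \<Longrightarrow> (f has_integral F b - F a) {a..b}"
    "(F \<longlongrightarrow> 0) at_bot" "(F \<longlongrightarrow> (LINT x|lebesgue. f x)) at_top"
    using f by (rule integrable_antiderivative) (rule that)
  have "AE x in lebesgue. f x = \<alpha> * u x * v x + W x * deriv v x"
    using c AE_deriv_eq_0[OF vs]
  proof eventually_elim
    case (elim x)
    show ?case
    proof (cases "x \<in> G")
      case True
      then have "deriv u x = 2 * W x" using elim by (simp add: W_def)
      then show ?thesis by (simp add: f_def algebra_simps)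
    qed (use elim in \<open>simp add: f_def\<close>)
  qed
  then have neg: "negligible {x. \<not> f x = \<alpha> * u x * v x + W x * deriv v x}" by (simp only: AE_lebesgue_iff_negligible)
  have "W b * v b - W a * v a = F b - F a" if "a \<le> b" for a b
  proof (rule has_integral_unique[OF _ F(1)[OF that]])
    show "(f has_integral W b * v b - W a * v a) {a..b}"
      by (rule has_integral_spike[OF neg _ product_rule_has_integral[OF W cW acv that]]) auto
  qed
  then have eq: "(\<lambda>x. W x * v x) = (\<lambda>x. F x + (W 0 * v 0 - F 0))"
    by (rule equal_increments)
  have "((\<lambda>x. W x * v x) \<longlongrightarrow> 0 + (W 0 * v 0 - F 0)) at_bot"
    "((\<lambda>x. W x * v x) \<longlongrightarrow> (LINT x|lebesgue. f x) + (W 0 * v 0 - F 0)) at_top"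
    unfolding eq by (intro tendsto_add F tendsto_const)+
  then have "0 + (W 0 * v 0 - F 0) = 0" "(LINT x|lebesgue. f x) + (W 0 * v 0 - F 0) = 0"
    using limits_zero_of_L2[OF W u2(1) v2(1)] by blast+
  then show ?thesis using E by simp
qed

end

section \<open>The orthogonal complements\<close>

text \<open>
  The identity for pairs of points says that \<open>w - 2 \<alpha> U\<close> is constant off the null set. If the null
  set exhausts \<open>G\<close>, any constant serves.
\<close>
lemma null_set_iff_AE_constant:
  fixes u U :: "real \<Rightarrow> real"
  assumes u: "continuous_on UNIV u" and U: "\<And>x. (U has_real_derivative u x) (at x)"
  shows "(\<exists>N \<in> null_sets lebesgue. \<forall>x \<in> G - N. \<forall>y \<in> G - N.
            w x - w y = 2 * \<alpha> * (LBINT z=ereal y..ereal x. u z))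
       \<longleftrightarrow> (\<exists>c. AE x in lebesgue. x \<in> G \<longrightarrow> w x - 2 * \<alpha> * U x = c)"
proof -
  have I: "(LBINT z=ereal y..ereal x. u z) = U x - U y" for x y
    by (rule interval_integral_FTC_finite)
      (use u U in \<open>auto simp: has_real_derivative_iff_has_vector_derivative[symmetric] intro: has_field_derivative_at_within continuous_on_subset\<close>)
  show ?thesis
  proof
    assume "\<exists>N \<in> null_sets lebesgue. \<forall>x \<in> G - N. \<forall>y \<in> G - N. w x - w y = 2 * \<alpha> * (LBINT z=ereal y..ereal x. u z)"
    then obtain N where N: "N \<in> null_sets lebesgue"
      "\<And>x y. x \<in> G - N \<Longrightarrow> y \<in> G - N \<Longrightarrow> w x - w y = 2 * \<alpha> * (U x - U y)" unfolding I by blast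
    have "\<exists>c. \<forall>x \<in> G - N. w x - 2 * \<alpha> * U x = c"
    proof (cases "G - N = {}")
      case False
      then obtain y where "y \<in> G - N" by blast
      then show ?thesis using N(2)[of _ y] by (intro exI[of _ "w y - 2 * \<alpha> * U y"]) (auto simp: algebra_simps)
    qed auto
    then obtain c where c: "\<And>x. x \<in> G - N \<Longrightarrow> w x - 2 * \<alpha> * U x = c" by blast
    have "AE x in lebesgue. x \<notin> N" using N(1) by (rule AE_not_in)
    then have "AE x in lebesgue. x \<in> G \<longrightarrow> w x - 2 * \<alpha> * U x = c" by eventually_elim (use c in blast)
    then show "\<exists>c. AE x in lebesgue. x \<in> G \<longrightarrow> w x - 2 * \<alpha> * U x = c" by blast
  next
    assume "\<exists>c. AE x in lebesgue. x \<in> G \<longrightarrow> w x - 2 * \<alpha> * U x = c"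
    then obtain c where c: "AE x in lebesgue. x \<in> G \<longrightarrow> w x - 2 * \<alpha> * U x = c" by blast
    define N where "N = {x. \<not> (x \<in> G \<longrightarrow> w x - 2 * \<alpha> * U x = c)}"
    have "N \<in> null_sets lebesgue"
      using c unfolding AE_lebesgue_iff_negligible negligible_iff_null_sets N_def .
    moreover have "w x - w y = 2 * \<alpha> * (U x - U y)" if "x \<in> G - N" "y \<in> G - N" for x y
      using that by (simp add: N_def algebra_simps)
    ultimately show "\<exists>N \<in> null_sets lebesgue. \<forall>x \<in> G - N. \<forall>y \<in> G - N. w x - w y = 2 * \<alpha> * (LBINT z=ereal y..ereal x. u z)"
      unfolding I by blast
  qed
qed

context scaling_function
begin

lemma orth_compl_0: "orth_compl s 0 = {u \<in> H1e. \<exists>c. AE x in lebesgue. x \<in> G \<longrightarrow> deriv u x = c}"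
proof -
  have "(\<forall>v\<in>Fse s. Eform u v = 0) \<longleftrightarrow> (\<exists>c. AE x in lebesgue. x \<in> G \<longrightarrow> deriv u x = c)" if u: "u \<in> H1e" for u
  proof
    assume *: "\<forall>v\<in>Fse s. Eform u v = 0"
    have "continuous_on UNIV u" using u abs_cont_continuous by (auto simp: H1e_def)
    then obtain U where U: "\<And>x. (U has_real_derivative u x) (at x)" by (rule antiderivative_exists) (rule that)
    show "\<exists>c. AE x in lebesgue. x \<in> G \<longrightarrow> deriv u x = c"
      using orthogonal_imp_affine_on_G[OF u _ U, of 0] * Fs_subset_Fse by (simp add: Eform_alpha_def)
  qed (use Eform_eq_0_of_constant_on_G[OF u] in blast)
  then show ?thesis by (auto simp: orth_compl_def)
qed

lemma H1_subset_H1e: "H1 \<subseteq> H1e"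
  by (auto simp: H1_def H1e_def)

lemma orth_compl_pos:
  assumes "\<alpha> \<noteq> 0"
  shows "orth_compl s \<alpha> = {u \<in> H1. \<exists>N \<in> null_sets lebesgue. \<forall>x \<in> G - N. \<forall>y \<in> G - N.
                deriv u x - deriv u y = 2 * \<alpha> * (LBINT z=ereal y..ereal x. u z)}"
proof -
  have "(\<forall>v\<in>Fs s. Eform_alpha \<alpha> u v = 0) \<longleftrightarrow> (\<exists>N \<in> null_sets lebesgue. \<forall>x \<in> G - N. \<forall>y \<in> G - N.
                deriv u x - deriv u y = 2 * \<alpha> * (LBINT z=ereal y..ereal x. u z))" if u: "u \<in> H1" for u
  proof -
    have c: "continuous_on UNIV u" using u abs_cont_continuous by (auto simp: H1_def)
    then obtain U where U: "\<And>x. (U has_real_derivative u x) (at x)" by (rule antiderivative_exists) (rule that)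
    show ?thesis
      unfolding null_set_iff_AE_constant[OF c U]
      using orthogonal_imp_affine_on_G[OF subsetD[OF H1_subset_H1e u] _ U] affine_on_G_imp_orthogonal[OF u U] by blast
  qed
  then show ?thesis using assms by (auto simp: orth_compl_def)
qed

end

theorem theorem2p2:
  fixes s :: "real \<Rightarrow> real" and G :: "real set" and \<alpha> :: real
  assumes "strict_mono s"
    and "abs_cont s"
    and "AE x in lebesgue. (s has_real_derivative 0) (at x) \<or> (s has_real_derivative 1) (at x)"
    and "open G"
    and "AE x in lebesgue. x \<in> G \<longleftrightarrow> (s has_real_derivative 1) (at x)"
    and "\<alpha> \<ge> 0"
  shows "orth_compl s \<alpha> =
           {u \<in> (if \<alpha> = 0 then H1e else H1).
              \<exists>N \<in> null_sets lebesgue. \<forall>x \<in> G - N. \<forall>y \<in> G - N.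
                deriv u x - deriv u y = 2 * \<alpha> * (LBINT z=ereal y..ereal x. u z)}
       \<and> orth_compl s 0 = {u \<in> H1e. \<exists>c. AE x in lebesgue. x \<in> G \<longrightarrow> deriv u x = c}"
proof
  interpret scaling_function s G using assms(1-5) by unfold_locales
  show zero: "orth_compl s 0 = {u \<in> H1e. \<exists>c. AE x in lebesgue. x \<in> G \<longrightarrow> deriv u x = c}"
    by (rule orth_compl_0)
  show "orth_compl s \<alpha> =
           {u \<in> (if \<alpha> = 0 then H1e else H1).
              \<exists>N \<in> null_sets lebesgue. \<forall>x \<in> G - N. \<forall>y \<in> G - N.
                deriv u x - deriv u y = 2 * \<alpha> * (LBINT z=ereal y..ereal x. u z)}"
  proof (cases "\<alpha> = 0")
    case False
    then show ?thesis using orth_compl_pos by simp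
  next
    case True
    have "(\<exists>c. AE x in lebesgue. x \<in> G \<longrightarrow> deriv u x = c) \<longleftrightarrow> (\<exists>N \<in> null_sets lebesgue. \<forall>x \<in> G - N. \<forall>y \<in> G - N.
                deriv u x - deriv u y = 2 * \<alpha> * (LBINT z=ereal y..ereal x. u z))" if u: "u \<in> H1e" for u
    proof -
      have c: "continuous_on UNIV u" using u abs_cont_continuous by (auto simp: H1e_def)
      then obtain U where U: "\<And>x. (U has_real_derivative u x) (at x)" by (rule antiderivative_exists) (rule that)
      show ?thesis unfolding null_set_iff_AE_constant[OF c U] using True by simp
    qed
    then show ?thesis using True zero by auto
  qed
qed

end
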